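(* Let $\lambda>0$. If an equilibrium value function $V^\lambda$ of the entropy-regularized outer problem with temperature $\lambda$ exists, then it satisfies $$V^0(x,t,z)-\frac{\lambda}{\beta}\sup_{z'\in[0,1]}\mathcal E(z')\ \le\ V^\lambda(x,t,z)\ \le\ V^0(x,t,z)-\frac{\lambda}{\beta}\mathcal E(1),\qquad\forall (x,t,z)\in\mathcal R,$$ where $V^0(x,t,z):=(1-z)\Phi(x)$. Consequently, $\lim_{\lambda\to0}V^\lambda=V^0$ in $C^0(\mathcal R)$ (i.e. uniformly on $\mathcal R$).
   Context: Constants: $\mu\in\mathbb R$, $\sigma>0$, $a>0$, $c>0$, $\beta>0$ with $\beta>\mu a+\frac12\sigma^2a^2$; $\mathcal E:[0,1]\to\mathbb R$ is the entropy function, assumed differentiable. Put $b:=\frac{\sqrt{\mu^2+2\beta\sigma^2}-\mu}{\sigma^2}$ (so $b>a$), $C_a:=\frac{1}{\beta-\mu a-\frac12\sigma^2a^2}$, $\hat x:=\frac1a\ln\frac{bc(\beta-\mu a-\frac12\sigma^2a^2)}{ba-a^2}$, $C_b:=-\frac{a^2}{b^2}C_a e^{(a-b)\hat x}$; $\Phi(x)=C_ae^{ax}+C_be^{bx}$ for $x<\hat x$ and $\Phi(x)=c(x-\hat x)+C_ae^{a\hat x}+C_be^{b\hat x}$ for $x\ge\hat x$; $\Psi(p,q)=C_ae^{ap}+e^{-\beta q}\int_{-\infty}^{\infty}\frac{1}{\sqrt{2\pi\sigma^2q}}e^{-\frac{(y-p-\mu q)^2}{2\sigma^2q}}[\Phi(y)-C_ae^{ay}]\,dy$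 for $q>0$, $\Psi(p,0)=\Phi(p)$; $U(x,t,r):=\Psi(x,r-t)$ for $0\le t\le r$. $B$ is a standard Brownian motion on a filtered probability space satisfying the usual conditions, $\{\mathcal F^B_r\}$ is its right-continuous filtration, and $X$ is the uncontrolled state: $dX_r=\mu\,dr+\sigma\,dB_r$, $r\ge t$, $X_t=x$. Let $\mathcal R:=\mathbb R\times[0,+\infty)\times[0,1]$. $\mathbb E_{x,t,z}$ is conditional expectation given $X_{t-}=x$, $\eta_{t-}=z$. $\mathcal D_{t,z}$ is the set of $\eta=\{\eta_r\}_{r\ge t}$ that are non-decreasing, càdlàg, $\{\mathcal F^B_r\}_{r\ge t}$-adapted, with $\eta_{t-}=z$ and $\lim_{r\to\infty}\eta_r=1$ a.s. (a jump at time $t$ is allowed and is counted in $\int_t^\infty\cdot\,d\eta_r$). For $\eta\in\mathcal D_{t,z}$, $$J(x,t,z;\eta)=J^\lambda(x,t,z;\eta):=\mathbb E_{x,t,z}\Big\{\int_t^{\infty}U(X_t,t,r)\,d\eta_r-\lambda\int_t^\infty e^{-\beta(r-t)}\mathcal E(\eta_r)\,dr\Big\}.$$ Admissible auxiliary singular control law: a partition $\Upsilon=(\mathcal W^\Upsilon,(\mathcal W^\Upsilon)^c)$ of $\mathcal R$ such that $(x,t,1)\in\mathcal W^\Upsilon$ for all $(x,t)\in\mathbb R\times[0,\infty)$ and, for every $(x,t,z)\in\mathcal R$, the Skorokhod reflection problem $dX_r=\mu dr+\sigma dB_r$; $(X_r,r,\eta_r)\in\overline{\mathcal W^\Upsilon}$;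 $\eta_r=z+\int_t^r 1_{\{(X_{r'-},r',\eta_{r'-})\notin\mathcal W^\Upsilon\}}\,d\eta_{r'}$ for all $r\ge t$; $X_{t-}=x$, has a unique strong solution $\eta=:\eta^{x,t,z,\Upsilon}$ (the control generated by $\Upsilon$ at $(x,t,z)$), with $\eta^{x,t,z,\Upsilon}\in\mathcal D_{t,z}$. Equilibrium: an admissible law $\hat\Upsilon$ is an equilibrium auxiliary singular control law, with equilibrium value function $J(x,t,z;\eta^{x,t,z,\hat\Upsilon})$ at $(x,t,z)$, if for every $(x,t,z)\in\mathcal R$ and every $\eta'\in\mathcal D_{t,z}$ for which there is a constant $M>0$ with $\eta'_{(t+h)-}-\eta'_t\le Mh$ for all sufficiently small $h>0$, one has $\liminf_{h\to0}\frac{J(x,t,z;\eta^h)-J(x,t,z;\eta^{x,t,z,\hat\Upsilon})}{h}\ge0$, where $\eta^h_r=\eta'_r$ for $r\in[t,t+h)$ and $\eta^h_r=\eta^{X_{(t+h)-},t+h,\eta'_{(t+h)-},\hat\Upsilon}_r$ for $r\ge t+h$. *)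

theory Defs
  imports "HOL-Probability.Probability"
begin

definition state_space :: "(real \<times> real \<times> real) set" where
  "state_space = UNIV \<times> {0..} \<times> {0..1}"

definition left_lim :: "(real \<Rightarrow> real) \<Rightarrow> real \<Rightarrow> real" where
  "left_lim f r = Lim (at_left r) f"

text \<open>Times are real numbers; only \<open>F r\<close> and \<open>B r\<close> with \<open>0 \<le> r\<close> are constrained or used.
  Completeness of \<open>M\<close> and the assumptions on \<open>F\<close> are the usual conditions.\<close>

locale outer_problem = prob_space M + complete_measure M
  for M :: "'w measure" +
  fixes F :: "real \<Rightarrow> 'w measure"
    and B :: "real \<Rightarrow> 'w \<Rightarrow> real"
    and \<mu> \<sigma> a c \<beta> :: real
    and Ent :: "real \<Rightarrow> real"
  assumes F_subalgebra: "\<And>r. 0 \<le> r \<Longrightarrow> subalgebra M (F r)"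
    and F_mono: "\<And>s r. 0 \<le> s \<Longrightarrow> s \<le> r \<Longrightarrow> sets (F s) \<subseteq> sets (F r)"
    and F_null_sets: "null_sets M \<subseteq> sets (F 0)"
    and F_right_continuous: "\<And>r. 0 \<le> r \<Longrightarrow> sets (F r) = (\<Inter>s\<in>{r<..}. sets (F s))"
    and B_adapted: "\<And>r. 0 \<le> r \<Longrightarrow> B r \<in> borel_measurable (F r)"
    and B_start: "AE \<omega> in M. B 0 \<omega> = 0"
    and B_continuous: "AE \<omega> in M. continuous_on {0..} (\<lambda>r. B r \<omega>)"
    and B_increment_normal: "\<And>s r. 0 \<le> s \<Longrightarrow> s < r \<Longrightarrow>
          distributed M lborel (\<lambda>\<omega>. B r \<omega> - B s \<omega>) (normal_density 0 (sqrt (r - s)))"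
    and B_increment_indep: "\<And>s r. 0 \<le> s \<Longrightarrow> s < r \<Longrightarrow>
          indep_set (sets (F s))
            {(\<lambda>\<omega>. B r \<omega> - B s \<omega>) -` A \<inter> space M | A. A \<in> sets borel}"
    and \<sigma>_pos: "\<sigma> > 0" and a_pos: "a > 0" and c_pos: "c > 0" and \<beta>_pos: "\<beta> > 0"
    and \<beta>_gt: "\<beta> > \<mu> * a + \<sigma>\<^sup>2 * a\<^sup>2 / 2"
    and Ent_differentiable: "Ent differentiable_on {0..1}"
begin

definition b_exp :: real where
  "b_exp = (sqrt (\<mu>\<^sup>2 + 2 * \<beta> * \<sigma>\<^sup>2) - \<mu>) / \<sigma>\<^sup>2"

definition C_a :: real where
  "C_a = 1 / (\<beta> - \<mu> * a - \<sigma>\<^sup>2 * a\<^sup>2 / 2)"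

definition x_hat :: real where
  "x_hat = (1 / a) * ln (b_exp * c * (\<beta> - \<mu> * a - \<sigma>\<^sup>2 * a\<^sup>2 / 2) / (b_exp * a - a\<^sup>2))"

definition C_b :: real where
  "C_b = - (a\<^sup>2 / b_exp\<^sup>2) * C_a * exp ((a - b_exp) * x_hat)"

definition Phi :: "real \<Rightarrow> real" where
  "Phi x = (if x < x_hat then C_a * exp (a * x) + C_b * exp (b_exp * x)
            else c * (x - x_hat) + C_a * exp (a * x_hat) + C_b * exp (b_exp * x_hat))"

text \<open>The Gaussian kernel has mean \<open>p + \<mu> * q\<close> and variance \<open>\<sigma>\<^sup>2 * q\<close>; \<open>normal_density\<close> takes
  the standard deviation.  Only \<open>0 \<le> q\<close> matters.\<close>

definition Psi :: "real \<Rightarrow> real \<Rightarrow> real" where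
  "Psi p q = (if q > 0
     then C_a * exp (a * p) + exp (- \<beta> * q) *
       (LBINT y. normal_density (p + \<mu> * q) (\<sigma> * sqrt q) y * (Phi y - C_a * exp (a * y)))
     else Phi p)"

definition U :: "real \<Rightarrow> real \<Rightarrow> real \<Rightarrow> real" where
  "U x t r = Psi x (r - t)"

text \<open>\<open>FB\<close> is the right-continuous version of the filtration generated by \<open>B\<close>; no null sets
  are added.\<close>

definition nat_filt :: "real \<Rightarrow> 'w measure" where
  "nat_filt s = sigma (space M) {B u -` A \<inter> space M | u A. 0 \<le> u \<and> u \<le> s \<and> A \<in> sets borel}"

definition FB :: "real \<Rightarrow> 'w measure" where
  "FB r = sigma (space M) (\<Inter>s\<in>{r<..}. sets (nat_filt s))"

text \<open>The solution of \<open>dX = \<mu> dr + \<sigma> dB\<close> on \<open>[s, \<infinity>)\<close> started from the (possibly random)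
  value \<open>\<xi>\<close>.  It is prolonged by \<open>\<xi>\<close> to the left of \<open>s\<close>, so that its left limit at \<open>s\<close> is
  \<open>\<xi>\<close> (also for \<open>s = 0\<close>).\<close>

definition X :: "('w \<Rightarrow> real) \<Rightarrow> real \<Rightarrow> real \<Rightarrow> 'w \<Rightarrow> real" where
  "X \<xi> s r \<omega> = (if r < s then \<xi> \<omega> else \<xi> \<omega> + \<mu> * (r - s) + \<sigma> * (B r \<omega> - B s \<omega>))"

text \<open>A process \<open>(\<eta> r)\<close>, \<open>r \<ge> s\<close>, with left limit \<open>\<zeta>\<close> at \<open>s\<close> is likewise prolonged by
  \<open>\<zeta>\<close> to the left of \<open>s\<close>.  The Stieltjes measure of a path, restricted to \<open>{s..}\<close>, then has
  the atom \<open>\<eta> s \<omega> - \<zeta> \<omega>\<close> at \<open>s\<close>.  Left limits of the paths exist by monotonicity.\<close>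

definition increasing_process :: "real \<Rightarrow> ('w \<Rightarrow> real) \<Rightarrow> (real \<Rightarrow> 'w \<Rightarrow> real) \<Rightarrow> bool" where
  "increasing_process s \<zeta> \<eta> \<longleftrightarrow>
     (\<forall>\<omega>\<in>space M. mono (\<lambda>r. \<eta> r \<omega>) \<and> (\<forall>r. continuous (at_right r) (\<lambda>r. \<eta> r \<omega>)) \<and>
        (\<forall>r<s. \<eta> r \<omega> = \<zeta> \<omega>)) \<and>
     (\<forall>r\<ge>s. \<eta> r \<in> borel_measurable (FB r))"

definition controls :: "real \<Rightarrow> real \<Rightarrow> (real \<Rightarrow> 'w \<Rightarrow> real) set" where
  "controls t z = {\<eta>. increasing_process t (\<lambda>_. z) \<eta> \<and>
     (AE \<omega> in M. ((\<lambda>r. \<eta> r \<omega>) \<longlongrightarrow> 1) at_top)}"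

text \<open>The cost \<open>J(x,t,z;\<eta>)\<close> at temperature \<open>lam\<close>.  The datum \<open>z\<close> is carried by
  \<open>\<eta> \<in> controls t z\<close>, and the conditioning on the initial data by starting \<open>X\<close> in \<open>x\<close>.\<close>

definition cost :: "real \<Rightarrow> real \<Rightarrow> real \<Rightarrow> (real \<Rightarrow> 'w \<Rightarrow> real) \<Rightarrow> real" where
  "cost lam x t \<eta> = expectation (\<lambda>\<omega>.
     (LINT r:{t..}|interval_measure (\<lambda>r. \<eta> r \<omega>). U (X (\<lambda>_. x) t t \<omega>) t r)
     - lam * (LINT r:{t..}|lborel. exp (- \<beta> * (r - t)) * Ent (\<eta> r \<omega>)))"

text \<open>A strong solution of the Skorokhod reflection problem for the law with waiting region \<open>W\<close>,
  started at time \<open>s\<close> from the (possibly random) data \<open>\<xi>, \<zeta>\<close>.\<close>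

definition reflection_solution ::
  "(real \<times> real \<times> real) set \<Rightarrow> real \<Rightarrow> ('w \<Rightarrow> real) \<Rightarrow> ('w \<Rightarrow> real) \<Rightarrow> (real \<Rightarrow> 'w \<Rightarrow> real) \<Rightarrow> bool"
where
  "reflection_solution W s \<xi> \<zeta> \<eta> \<longleftrightarrow>
     increasing_process s \<zeta> \<eta> \<and>
     (AE \<omega> in M. \<forall>r\<ge>s. (X \<xi> s r \<omega>, r, \<eta> r \<omega>) \<in> closure W) \<and>
     (AE \<omega> in M. \<forall>r\<ge>s.
        (let m = interval_measure (\<lambda>r. \<eta> r \<omega>);
             outside = (\<lambda>r'. indicator (- W)
               (left_lim (\<lambda>u. X \<xi> s u \<omega>) r', r', left_lim (\<lambda>u. \<eta> u \<omega>) r') :: real)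
         in set_integrable m {s..r} outside \<and>
            \<eta> r \<omega> = \<zeta> \<omega> + (LINT r':{s..r}|m. outside r')))"

definition generated_control ::
  "(real \<times> real \<times> real) set \<Rightarrow> real \<Rightarrow> real \<Rightarrow> real \<Rightarrow> real \<Rightarrow> 'w \<Rightarrow> real" where
  "generated_control W x t z = (SOME \<eta>. reflection_solution W t (\<lambda>_. x) (\<lambda>_. z) \<eta>)"

text \<open>The partition of the state space is \<open>(W, state_space - W)\<close>.  Uniqueness is up to
  indistinguishability; \<open>generated_control\<close> picks a version.\<close>

definition admissible :: "(real \<times> real \<times> real) set \<Rightarrow> bool" where
  "admissible W \<longleftrightarrow>
     W \<subseteq> state_space \<and>
     (\<forall>x. \<forall>t\<ge>0. (x, t, 1) \<in> W) \<and>
     (\<forall>x t z. (x, t, z) \<in> state_space \<longrightarrow>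
        (\<exists>\<eta>. reflection_solution W t (\<lambda>_. x) (\<lambda>_. z) \<eta>) \<and>
        (\<forall>\<eta> \<eta>'. reflection_solution W t (\<lambda>_. x) (\<lambda>_. z) \<eta> \<longrightarrow>
           reflection_solution W t (\<lambda>_. x) (\<lambda>_. z) \<eta>' \<longrightarrow>
           (AE \<omega> in M. \<forall>r. \<eta> r \<omega> = \<eta>' r \<omega>)) \<and>
        generated_control W x t z \<in> controls t z)"

definition concat_control ::
  "real \<Rightarrow> (real \<Rightarrow> 'w \<Rightarrow> real) \<Rightarrow> (real \<Rightarrow> 'w \<Rightarrow> real) \<Rightarrow> real \<Rightarrow> 'w \<Rightarrow> real" where
  "concat_control s \<eta>' \<theta> r \<omega> = (if r < s then \<eta>' r \<omega> else \<theta> r \<omega>)"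

text \<open>In the perturbed control the law takes over at time \<open>t + h\<close> from the random state reached
  by then.  Since solutions are determined only up to a null set depending on the initial datum,
  random data cannot simply be substituted into \<open>generated_control\<close>; the continuation \<open>\<theta> h\<close> is
  instead the solution of the reflection problem with these random data.\<close>

definition equilibrium_law :: "real \<Rightarrow> (real \<times> real \<times> real) set \<Rightarrow> bool" where
  "equilibrium_law lam W \<longleftrightarrow>
     admissible W \<and>
     (\<forall>x t z. (x, t, z) \<in> state_space \<longrightarrow>
       (\<forall>\<eta>'\<in>controls t z.
         (\<exists>K>0. \<forall>\<^sub>F h in at_right 0.
            AE \<omega> in M. left_lim (\<lambda>r. \<eta>' r \<omega>) (t + h) - \<eta>' t \<omega> \<le> K * h) \<longrightarrow>
         (\<forall>\<theta>. (\<forall>\<^sub>F h in at_right 0.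
             reflection_solution W (t + h)
               (\<lambda>\<omega>. left_lim (\<lambda>r. X (\<lambda>_. x) t r \<omega>) (t + h))
               (\<lambda>\<omega>. left_lim (\<lambda>r. \<eta>' r \<omega>) (t + h)) (\<theta> h) \<and>
             concat_control (t + h) \<eta>' (\<theta> h) \<in> controls t z) \<longrightarrow>
           0 \<le> Liminf (at_right 0) (\<lambda>h. ereal
             ((cost lam x t (concat_control (t + h) \<eta>' (\<theta> h))
               - cost lam x t (generated_control W x t z)) / h)))))"

definition equilibrium_value_function :: "real \<Rightarrow> (real \<times> real \<times> real \<Rightarrow> real) \<Rightarrow> bool" where
  "equilibrium_value_function lam V \<longleftrightarrow>
     (\<exists>W. equilibrium_law lam W \<and>
        (\<forall>x t z. (x, t, z) \<in> state_space \<longrightarrow>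
           V (x, t, z) = cost lam x t (generated_control W x t z)))"

definition V0 :: "real \<times> real \<times> real \<Rightarrow> real" where
  "V0 = (\<lambda>(x, t, z). (1 - z) * Phi x)"

end

end

theory Submission
  imports Defs "HOL-Real_Asymp.Real_Asymp"
begin

text \<open>Upper bound: jumping to \<open>1\<close> at time \<open>t\<close> is an admissible perturbation whose cost
  \<open>V0 - \<lambda> / \<beta> * Ent 1\<close> does not depend on \<open>h\<close>, because every law waits at \<open>z = 1\<close>; the
  equilibrium condition then compares two constants.  Lower bound: \<open>U x t r \<ge> Phi x\<close> for all
  \<open>r \<ge> t\<close>, so every control costs at least \<open>(1 - z) * Phi x\<close> up to the entropy term.  This
  inequality is Dynkin's formula for \<open>Phi y - C_a * exp (a * y)\<close>, a \<open>C\<^sup>2\<close> subsolution of the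
  generator; no stochastic calculus is used, since only the Gaussian marginals matter.\<close>

section \<open>Gaussian expectations\<close>

text \<open>The obstacle is the Bochner integral, whose value is 0 on functions that fail to be
  integrable: a pointwise lower bound for the cost says nothing until integrability is known, first
  along each path and then in \<open>\<omega>\<close>. Hence the upper estimate
  \<open>Psi_bounded_above\<close>, uniform in \<open>q\<close>; it rests on
  \<open>\<beta>_gt\<close>, since discounting has to beat the growth of the Gaussian moment of
  \<open>exp (a * y)\<close>. Hence also the measurability of the running cost, where completeness
  of \<open>M\<close> takes care of the null set of paths that do not tend to 1. The subsolution
  property comes from the constants: \<open>C_b\<close> is fixed by the second-order fit at
  \<open>x_hat\<close>, and \<open>x_hat\<close> itself by the first-order fit. The discounted
  generator of \<open>gap\<close> then vanishes left of \<open>x_hat\<close>; to the right it is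
  nonnegative because the exponential lies above its tangent at \<open>x_hat\<close>. Both final
  bounds differ from \<open>V0\<close> by \<open>lam\<close> times a number independent of the
  state, so the convergence is uniform although \<open>Phi\<close> is unbounded.\<close>

lemma normal_density_mult_exp:
  assumes "s > 0"
  shows "normal_density m s y * exp (k * y) =
    exp (k * m + k\<^sup>2 * s\<^sup>2 / 2) * normal_density (m + k * s\<^sup>2) s y"
proof -
  \<comment> \<open>Completing the square: tilting by an exponential shifts the mean and keeps the
    variance.\<close>
  have "- (y - m)\<^sup>2 / (2 * s\<^sup>2) + k * y
      = (k * m + k\<^sup>2 * s\<^sup>2 / 2) + - (y - (m + k * s\<^sup>2))\<^sup>2 / (2 * s\<^sup>2)"
    using assms by (simp add: field_simps power2_eq_square)
  then show ?thesis
    by (simp add: normal_density_def flip: exp_add)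
qed

lemma integral_normal_density_exp:
  assumes "s > 0"
  shows "integrable lborel (\<lambda>y. normal_density m s y * exp (k * y))"
    and "(LBINT y. normal_density m s y * exp (k * y)) = exp (k * m + k\<^sup>2 * s\<^sup>2 / 2)"
  using assms by (simp_all add: normal_density_mult_exp)

text \<open>Dominated by the sum of the two one-sided exponential moments, for either sign of
  \<open>k\<close>.\<close>

lemma integrable_normal_density_exp_abs:
  assumes "s > 0"
  shows "integrable lborel (\<lambda>y. normal_density m s y * exp (k * \<bar>y\<bar>))"
proof (rule Bochner_Integration.integrable_bound)
  show "integrable lborel
      (\<lambda>y. normal_density m s y * exp (k * y) + normal_density m s y * exp (- k * y))"
    by (intro Bochner_Integration.integrable_add integral_normal_density_exp assms)
  show "AE y in lborel. norm (normal_density m s y * exp (k * \<bar>y\<bar>))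
      \<le> norm (normal_density m s y * exp (k * y) + normal_density m s y * exp (- k * y))"
  proof (intro AE_I2)
    fix y :: real
    have "exp (k * \<bar>y\<bar>) \<le> exp (k * y) + exp (- k * y)"
      by (simp add: abs_if)
    from mult_left_mono[OF this normal_density_nonneg[of m s y]]
    show "norm (normal_density m s y * exp (k * \<bar>y\<bar>))
        \<le> norm (normal_density m s y * exp (k * y) + normal_density m s y * exp (- k * y))"
      by (simp add: distrib_left)
  qed
qed measurable

text \<open>Exponential growth is the class in which Gaussian integrability is checked below: it
  contains \<open>gap\<close> with its derivatives, and affine substitutions or an extra factor
  \<open>z\<close> only change \<open>C\<close> and \<open>k\<close>.\<close>

lemma integrable_normal_density_exp_growth:
  assumes "s > 0" and [measurable]: "f \<in> borel_measurable borel"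
    and bound: "\<And>y. \<bar>f y\<bar> \<le> C * exp (k * \<bar>y\<bar>)"
  shows "integrable lborel (\<lambda>y. normal_density m s y * f y)"
proof (rule Bochner_Integration.integrable_bound)
  show "integrable lborel (\<lambda>y. C * (normal_density m s y * exp (k * \<bar>y\<bar>)))"
    by (intro integrable_mult_right integrable_normal_density_exp_abs assms)
  show "AE y in lborel. norm (normal_density m s y * f y)
      \<le> norm (C * (normal_density m s y * exp (k * \<bar>y\<bar>)))"
  proof (intro AE_I2)
    fix y
    have "0 \<le> C"
      using bound[of 0] by simp
    then show "norm (normal_density m s y * f y)
        \<le> norm (C * (normal_density m s y * exp (k * \<bar>y\<bar>)))"
      using mult_left_mono[OF bound[of y] normal_density_nonneg[of m s y]]
      by (simp add: abs_mult mult_ac)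
  qed
qed measurable

text \<open>Moves mean and deviation from the density into the argument of \<open>f\<close>, where
  they can be differentiated under a fixed Gaussian weight.\<close>

lemma integral_normal_density_standardize:
  assumes "s > 0"
  shows "(LBINT y. normal_density m s y * f y) = (LBINT z. std_normal_density z * f (m + s * z))"
proof -
  have "s * normal_density m s (m + s * z) = std_normal_density z" for z
    using assms by (simp add: normal_density_def power_mult_distrib real_sqrt_mult)
  then have eq: "std_normal_density z * f (m + s * z)
      = s * (normal_density m s (m + s * z) * f (m + s * z))" for z
    by (metis mult.assoc)
  show ?thesis
    using assms unfolding eq by (subst lborel_integral_real_affine[of s _ m]) simp_all
qed

text \<open>Stein's identity, by integration of the derivative of the Gaussian density times \<open>f\<close>.\<close>

lemma std_normal_integration_by_parts:
  assumes deriv: "\<And>z. (f has_real_derivative f' z) (at z)" and cont: "\<And>z. isCont f' z"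
    and bound: "\<And>z. \<bar>f z\<bar> \<le> C * exp (k * \<bar>z\<bar>)" "\<And>z. \<bar>f' z\<bar> \<le> C * exp (k * \<bar>z\<bar>)"
  shows "integrable lborel (\<lambda>z. std_normal_density z * (z * f z))"
    and "(LBINT z. std_normal_density z * (z * f z)) = (LBINT z. std_normal_density z * f' z)"
proof -
  have cont_f: "isCont f z" for z
    using deriv DERIV_isCont by blast
  have [measurable]: "f \<in> borel_measurable borel" "f' \<in> borel_measurable borel"
    using cont cont_f by (simp_all add: borel_measurable_continuous_onI continuous_at_imp_continuous_on)
  have C: "0 \<le> C"
    using bound(1)[of 0] by simp
  have "\<bar>z * f z\<bar> \<le> C * exp ((k + 1) * \<bar>z\<bar>)" for z
  proof -
    \<comment> \<open>The polynomial factor is absorbed by one more unit in the exponent, hence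
      \<open>k + 1\<close>.\<close>
    have "\<bar>z\<bar> \<le> exp \<bar>z\<bar>"
      using exp_ge_add_one_self[of "\<bar>z\<bar>"] by linarith
    then have "\<bar>z\<bar> * \<bar>f z\<bar> \<le> exp \<bar>z\<bar> * (C * exp (k * \<bar>z\<bar>))"
      by (intro mult_mono bound) auto
    then show ?thesis
      by (simp add: abs_mult distrib_right exp_add mult_ac distrib_left)
  qed
  then show int_zf: "integrable lborel (\<lambda>z. std_normal_density z * (z * f z))"
    by (intro integrable_normal_density_exp_growth[where C=C and k="k+1"]) auto
  have int_f': "integrable lborel (\<lambda>z. std_normal_density z * f' z)"
    by (intro integrable_normal_density_exp_growth[where C=C and k=k] bound) auto
  have dens: "(std_normal_density has_real_derivative - z * std_normal_density z) (at z)" for z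
    unfolding std_normal_density_def
    by (rule derivative_eq_intros refl | simp)+
  \<comment> \<open>Boundary terms of the integration by parts, with the filter left open so that
    one squeeze serves both ends of the line.\<close>
  have lim: "((\<lambda>z. std_normal_density z * f z) \<longlongrightarrow> 0) F"
    if "((\<lambda>z. exp (k * \<bar>z\<bar> - z\<^sup>2 / 2)) \<longlongrightarrow> 0) F" for F
  proof (rule Lim_null_comparison[OF always_eventually tendsto_mult_right_zero[OF that]])
    have eq: "std_normal_density z * (C * exp (k * \<bar>z\<bar>)) = C / sqrt (2 * pi) * exp (k * \<bar>z\<bar> - z\<^sup>2 / 2)" for z
      by (simp add: std_normal_density_def exp_diff exp_minus inverse_eq_divide)
    show "\<forall>z. norm (std_normal_density z * f z) \<le> C / sqrt (2 * pi) * exp (k * \<bar>z\<bar> - z\<^sup>2 / 2)"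
      unfolding eq[symmetric]
      using mult_left_mono[OF bound(1) normal_density_nonneg[of 0 1]] by (auto simp: abs_mult)
  qed
  have lim_top: "((\<lambda>z::real. exp (k * \<bar>z\<bar> - z\<^sup>2 / 2)) \<longlongrightarrow> 0) at_top"
    by real_asymp
  have lim_bot: "((\<lambda>z::real. exp (k * \<bar>z\<bar> - z\<^sup>2 / 2)) \<longlongrightarrow> 0) at_bot"
    by real_asymp
  have "(LBINT z=-\<infinity>..\<infinity>. std_normal_density z * f' z - std_normal_density z * (z * f z)) = 0 - 0"
  proof (rule interval_integral_FTC_integrable[where F="\<lambda>z. std_normal_density z * f z"])
    show "((\<lambda>z. std_normal_density z * f z) has_vector_derivative
        std_normal_density z * f' z - std_normal_density z * (z * f z)) (at z)" for z
      unfolding has_real_derivative_iff_has_vector_derivative[symmetric]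
      by (auto intro!: derivative_eq_intros dens deriv simp: algebra_simps)
    show "isCont (\<lambda>z. std_normal_density z * f' z - std_normal_density z * (z * f z)) z" for z
      using dens[THEN DERIV_isCont] by (intro continuous_intros cont cont_f)
    show "set_integrable lborel (einterval (-\<infinity>) \<infinity>)
        (\<lambda>z. std_normal_density z * f' z - std_normal_density z * (z * f z))"
      using int_zf int_f' by (simp add: set_integrable_def)
  qed (auto simp: ereal_tendsto_simps intro!: lim lim_top lim_bot)
  then show "(LBINT z. std_normal_density z * (z * f z)) = (LBINT z. std_normal_density z * f' z)"
    using int_zf int_f' by (simp add: interval_lebesgue_integral_def set_lebesgue_integral_def)
qed

text \<open>Dynkin's inequality without stochastic calculus: in the variable \<open>s = \<surd>q\<close> the expectation
  of \<open>g (p + \<mu> s\<^sup>2 + \<sigma> s Z)\<close>, \<open>Z\<close> standard normal, is differentiable down to \<open>s = 0\<close>, and by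
  Stein's identity its discounted derivative is \<open>2 s\<close> times the expectation of the generator.\<close>

lemma discounted_normal_expectation_ge:
  fixes g g1 g2 :: "real \<Rightarrow> real"
  assumes deriv: "\<And>y. (g has_real_derivative g1 y) (at y)"
      "\<And>y. (g1 has_real_derivative g2 y) (at y)"
    and cont: "\<And>y. isCont g2 y"
    and bound: "\<And>y. \<bar>g y\<bar> \<le> C * exp (k * \<bar>y\<bar>)" "\<And>y. \<bar>g1 y\<bar> \<le> C * exp (k * \<bar>y\<bar>)"
      "\<And>y. \<bar>g2 y\<bar> \<le> C * exp (k * \<bar>y\<bar>)" and "0 \<le> k"
    and subsolution: "\<And>y. 0 \<le> \<sigma>\<^sup>2 / 2 * g2 y + \<mu> * g1 y - \<beta> * g y"
    and "0 < \<sigma>" "0 \<le> \<beta>" "0 < q"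
  shows "g p \<le> exp (- \<beta> * q) * (LBINT y. normal_density (p + \<mu> * q) (\<sigma> * sqrt q) y * g y)"
proof -
  define S where "S = sqrt q"
  have S: "0 < S" "S\<^sup>2 = q"
    using \<open>0 < q\<close> by (simp_all add: S_def)
  define Y where "Y s z = p + \<mu> * s\<^sup>2 + \<sigma> * s * z" for s z
  define \<phi> where "\<phi> s z = exp (- \<beta> * s\<^sup>2) * g (Y s z)" for s z
  \<comment> \<open>The derivative of \<open>\<phi>\<close> in \<open>s\<close>. Differentiating in
    \<open>q = s\<^sup>2\<close> instead would produce a factor \<open>1 / sqrt q\<close>, singular
    at the left end of the interval.\<close>
  define \<psi> where "\<psi> s z =
    exp (- \<beta> * s\<^sup>2) * ((2 * \<mu> * s + \<sigma> * z) * g1 (Y s z) - 2 * \<beta> * s * g (Y s z))" for s z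
  have cont_g: "isCont g y" "isCont g1 y" for y
    using deriv DERIV_isCont by blast+
  have [measurable]: "g \<in> borel_measurable borel" "g1 \<in> borel_measurable borel"
      "g2 \<in> borel_measurable borel"
    using cont cont_g
    by (simp_all add: borel_measurable_continuous_onI continuous_at_imp_continuous_on)
  have Y_measurable [measurable]: "Y s \<in> borel_measurable borel" for s
    unfolding Y_def by measurable
  have C: "0 \<le> C"
    using bound(1)[of 0] by simp
  \<comment> \<open>Bounds the part of \<open>Y s z\<close> free of \<open>z\<close> for all
    \<open>s\<close> in \<open>{0..S}\<close>, so that \<open>C'\<close> and \<open>k'\<close> below
    are uniform in \<open>s\<close>.\<close>
  define R where "R = \<bar>p\<bar> + \<bar>\<mu>\<bar> * S\<^sup>2"
  have Y_bound: "\<bar>Y s z\<bar> \<le> R + \<sigma> * S * \<bar>z\<bar>" if "0 \<le> s" "s \<le> S" for s z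
  proof -
    have "\<bar>\<mu> * s\<^sup>2\<bar> \<le> \<bar>\<mu>\<bar> * S\<^sup>2"
      using that by (auto simp: abs_mult intro!: mult_left_mono power_mono)
    moreover have "\<bar>\<sigma> * s * z\<bar> \<le> \<sigma> * S * \<bar>z\<bar>"
      using that \<open>0 < \<sigma>\<close> by (auto simp: abs_mult intro!: mult_mono)
    ultimately show ?thesis
      unfolding Y_def R_def by linarith
  qed
  define C' where "C' = C * exp (k * R)"
  define k' where "k' = k * \<sigma> * S"
  have comp_bound: "\<bar>f (Y s z)\<bar> \<le> C' * exp (k' * \<bar>z\<bar>)"
    if "0 \<le> s" "s \<le> S" and "\<And>y. \<bar>f y\<bar> \<le> C * exp (k * \<bar>y\<bar>)" for f s z
  proof -
    have "\<bar>f (Y s z)\<bar> \<le> C * exp (k * \<bar>Y s z\<bar>)"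
      by (fact that)
    also have "\<dots> \<le> C * exp (k * (R + \<sigma> * S * \<bar>z\<bar>))"
      using Y_bound[OF that(1,2), of z] C \<open>0 \<le> k\<close> by (intro mult_left_mono) (auto intro: mult_left_mono)
    also have "\<dots> = C' * exp (k' * \<bar>z\<bar>)"
      by (simp add: C'_def k'_def distrib_left mult_ac flip: exp_add)
    finally show ?thesis .
  qed
  have C': "0 \<le> C'"
    using C by (simp add: C'_def)
  \<comment> \<open>Collects the largest values over \<open>{0..S}\<close> of the three coefficients
    in \<open>\<psi>\<close>; the factor \<open>z\<close> goes into
    \<open>exp \<bar>z\<bar>\<close>.\<close>
  define D where "D = (2 * \<bar>\<mu>\<bar> * S + \<sigma> + 2 * \<beta> * S) * C'"
  have \<psi>_bound: "\<bar>\<psi> s z\<bar> \<le> D * exp ((k' + 1) * \<bar>z\<bar>)" if s: "0 \<le> s" "s \<le> S" for s z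
  proof -
    let ?e = "exp \<bar>z\<bar>" and ?E = "C' * exp (k' * \<bar>z\<bar>)"
    have e: "1 \<le> ?e" "\<bar>z\<bar> \<le> ?e"
      using exp_ge_add_one_self[of "\<bar>z\<bar>"] by linarith+
    have "\<bar>2 * \<mu> * s + \<sigma> * z\<bar> \<le> 2 * \<bar>\<mu>\<bar> * S * 1 + \<sigma> * \<bar>z\<bar>"
      using s \<open>0 < \<sigma>\<close> mult_left_mono[of s S "\<bar>\<mu>\<bar>"] by (auto simp: abs_mult intro!: abs_triangle_ineq[THEN order_trans])
    also have "\<dots> \<le> 2 * \<bar>\<mu>\<bar> * S * ?e + \<sigma> * ?e"
      using e S \<open>0 < \<sigma>\<close> by (intro add_mono mult_left_mono) auto
    finally have 1: "\<bar>(2 * \<mu> * s + \<sigma> * z) * g1 (Y s z)\<bar> \<le> (2 * \<bar>\<mu>\<bar> * S + \<sigma>) * ?e * ?E"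
      unfolding abs_mult using S \<open>0 < \<sigma>\<close> comp_bound[of s g1, OF s bound(2)]
      by (intro mult_mono) (auto simp: distrib_right)
    have "2 * \<beta> * s \<le> 2 * \<beta> * S * ?e"
      using mult_mono[of "2 * \<beta> * s" "2 * \<beta> * S" 1 ?e] mult_left_mono[of s S "2 * \<beta>"] s e \<open>0 \<le> \<beta>\<close> S
      by simp
    then have 2: "\<bar>2 * \<beta> * s * g (Y s z)\<bar> \<le> 2 * \<beta> * S * ?e * ?E"
      unfolding abs_mult[of "2 * \<beta> * s"] using s S \<open>0 \<le> \<beta>\<close> comp_bound[of s g, OF s bound(1)]
      by (intro mult_mono) auto
    have "\<bar>\<psi> s z\<bar> \<le> 1 * \<bar>(2 * \<mu> * s + \<sigma> * z) * g1 (Y s z) - 2 * \<beta> * s * g (Y s z)\<bar>"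
      unfolding \<psi>_def abs_mult[of "exp _"] using \<open>0 \<le> \<beta>\<close> by (intro mult_right_mono) auto
    also have "\<dots> \<le> (2 * \<bar>\<mu>\<bar> * S + \<sigma>) * ?e * ?E + 2 * \<beta> * S * ?e * ?E"
      using 1 2 abs_triangle_ineq4[of "(2 * \<mu> * s + \<sigma> * z) * g1 (Y s z)" "2 * \<beta> * s * g (Y s z)"]
      by linarith
    also have "\<dots> = D * exp ((k' + 1) * \<bar>z\<bar>)"
      by (simp add: D_def algebra_simps exp_add)
    finally show ?thesis .
  qed
  have D: "0 \<le> D"
    using \<psi>_bound[of 0 0] S by simp
  \<comment> \<open>Justifies exchanging the \<open>s\<close>- and \<open>z\<close>-integrals: the
    integrand is dominated by the product of a Gaussian-integrable function of \<open>z\<close> and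
    the indicator of \<open>{0..S}\<close>.\<close>
  have "integrable (lborel \<Otimes>\<^sub>M lborel)
      (\<lambda>(z, s). std_normal_density z * (indicator {0..S} s * \<psi> s z))"
  proof (rule Bochner_Integration.integrable_bound)
    let ?h = "\<lambda>z. D * (std_normal_density z * exp ((k' + 1) * \<bar>z\<bar>))"
    have h: "integrable lborel ?h"
      by (intro integrable_mult_right integrable_normal_density_exp_abs) simp
    have ind: "integrable lborel (indicator {0..S} :: real \<Rightarrow> real)"
      using S by (intro integrable_real_indicator) (auto simp: ennreal_less_top)
    show "integrable (lborel \<Otimes>\<^sub>M lborel) (\<lambda>(z, s). ?h z * indicator {0..S} s)"
    proof (rule lborel_pair.Fubini_integrable)
      show "AE z in lborel. integrable lborel (\<lambda>s. case (z, s) of (z, s) \<Rightarrow> ?h z * indicator {0..S} s)"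
        using ind by simp
      have "(\<lambda>z. LBINT s. norm (case (z, s) of (z, s) \<Rightarrow> ?h z * indicator {0..S} s)) = (\<lambda>z. ?h z * S)"
        using D S by (simp add: abs_mult fun_eq_iff)
      then show "integrable lborel
          (\<lambda>z. LBINT s. norm (case (z, s) of (z, s) \<Rightarrow> ?h z * indicator {0..S} s))"
        using h by simp
    qed measurable
    show "(\<lambda>(z, s). std_normal_density z * (indicator {0..S} s * \<psi> s z))
        \<in> borel_measurable (lborel \<Otimes>\<^sub>M lborel)"
      unfolding \<psi>_def Y_def by measurable
    show "AE x in lborel \<Otimes>\<^sub>M lborel.
        norm (case x of (z, s) \<Rightarrow> std_normal_density z * (indicator {0..S} s * \<psi> s z))
        \<le> norm (case x of (z, s) \<Rightarrow> ?h z * indicator {0..S} s)"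
    proof (intro AE_I2, clarify)
      fix z s :: real
      show "norm (std_normal_density z * (indicator {0..S} s * \<psi> s z)) \<le> norm (?h z * indicator {0..S} s)"
        using mult_left_mono[OF \<psi>_bound[of s z] normal_density_nonneg[of 0 1 z]] D
        by (auto simp: indicator_def abs_mult mult_ac)
    qed
  qed
  note Fubini = lborel_pair.Fubini_integral[OF this]
  have FTC: "(LBINT s. indicator {0..S} s * \<psi> s z) = \<phi> S z - \<phi> 0 z" for z
  proof -
    have "continuous_on {0..S} (\<lambda>s. \<psi> s z)"
      unfolding \<psi>_def Y_def
      by (intro continuous_at_imp_continuous_on ballI continuous_intros isCont_o2[OF _ cont_g(1)]
          isCont_o2[OF _ cont_g(2)])
    moreover have "((\<lambda>s. \<phi> s z) has_vector_derivative \<psi> s z) (at s within {0..S})" for s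
      unfolding has_real_derivative_iff_has_vector_derivative[symmetric] \<phi>_def \<psi>_def Y_def
      by (rule DERIV_subset[OF _ subset_UNIV])
        (auto intro!: derivative_eq_intros DERIV_chain2[OF deriv(1)] simp: algebra_simps)
    ultimately show ?thesis
      using integral_FTC_atLeastAtMost[of 0 S "\<lambda>s. \<phi> s z" "\<lambda>s. \<psi> s z"] S by simp
  qed
  have inner: "0 \<le> (LBINT z. std_normal_density z * \<psi> s z)" if s: "0 \<le> s" "s \<le> S" for s
  proof -
    define G G1 G2 where "G z = g (Y s z)" and "G1 z = g1 (Y s z)" and "G2 z = g2 (Y s z)" for z
    have bounds: "\<bar>G z\<bar> \<le> C' * exp (k' * \<bar>z\<bar>)" "\<bar>G1 z\<bar> \<le> C' * exp (k' * \<bar>z\<bar>)"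
        "\<bar>G2 z\<bar> \<le> C' * exp (k' * \<bar>z\<bar>)" for z
      unfolding G_def G1_def G2_def using comp_bound[OF s] bound by auto
    have meas: "G \<in> borel_measurable borel" "G1 \<in> borel_measurable borel"
        "G2 \<in> borel_measurable borel"
      unfolding G_def[abs_def] G1_def[abs_def] G2_def[abs_def] by measurable
    have int: "integrable lborel (\<lambda>z. std_normal_density z * G z)"
        "integrable lborel (\<lambda>z. std_normal_density z * G1 z)"
        "integrable lborel (\<lambda>z. std_normal_density z * G2 z)"
      using bounds by (auto intro!: integrable_normal_density_exp_growth meas)
    \<comment> \<open>The chain rule gives \<open>G1\<close> the derivative
      \<open>\<sigma> * s * G2\<close>. Thus Stein's identity supplies the factor \<open>s\<close>
      that the drift and discount terms already carry, and \<open>2 * s\<close> times the generator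
      remains.\<close>
    have stein: "integrable lborel (\<lambda>z. std_normal_density z * (z * G1 z))"
        "(LBINT z. std_normal_density z * (z * G1 z)) = (LBINT z. std_normal_density z * (\<sigma> * s * G2 z))"
    proof -
      have "(G1 has_real_derivative \<sigma> * s * G2 z) (at z)" for z
        unfolding G1_def G2_def Y_def
        by (rule DERIV_cong[OF DERIV_chain2[OF deriv(2)]]) (auto intro!: derivative_eq_intros)
      moreover have "isCont (\<lambda>z. \<sigma> * s * G2 z) z" for z
        unfolding G2_def Y_def by (intro continuous_intros isCont_o2[OF _ cont])
      \<comment> \<open>Stein's identity takes one growth constant for a function and its
        derivative; \<open>(1 + \<sigma> * s) * C'\<close> covers both.\<close>
      moreover have "\<bar>G1 z\<bar> \<le> (1 + \<sigma> * s) * C' * exp (k' * \<bar>z\<bar>)"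
          "\<bar>\<sigma> * s * G2 z\<bar> \<le> (1 + \<sigma> * s) * C' * exp (k' * \<bar>z\<bar>)" for z
      proof -
        have "0 \<le> \<sigma> * s * (C' * exp (k' * \<bar>z\<bar>))" "0 \<le> C' * exp (k' * \<bar>z\<bar>)"
          using s C' \<open>0 < \<sigma>\<close> by auto
        moreover have "\<bar>\<sigma> * s * G2 z\<bar> \<le> \<sigma> * s * (C' * exp (k' * \<bar>z\<bar>))"
          unfolding abs_mult[of "\<sigma> * s"] using s \<open>0 < \<sigma>\<close> bounds(3)[of z]
          by (auto intro!: mult_left_mono)
        ultimately show "\<bar>G1 z\<bar> \<le> (1 + \<sigma> * s) * C' * exp (k' * \<bar>z\<bar>)"
            "\<bar>\<sigma> * s * G2 z\<bar> \<le> (1 + \<sigma> * s) * C' * exp (k' * \<bar>z\<bar>)"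
          using bounds(2)[of z] by (simp_all add: distrib_right mult.assoc)
      qed
      ultimately show "integrable lborel (\<lambda>z. std_normal_density z * (z * G1 z))"
        "(LBINT z. std_normal_density z * (z * G1 z)) = (LBINT z. std_normal_density z * (\<sigma> * s * G2 z))"
        by (rule std_normal_integration_by_parts)+
    qed
    have "std_normal_density z * \<psi> s z = exp (- \<beta> * s\<^sup>2) *
        (\<sigma> * (std_normal_density z * (z * G1 z)) + 2 * s * \<mu> * (std_normal_density z * G1 z)
          - 2 * s * \<beta> * (std_normal_density z * G z))" for z
      by (simp add: \<psi>_def G_def G1_def algebra_simps)
    then have "(LBINT z. std_normal_density z * \<psi> s z) = exp (- \<beta> * s\<^sup>2) *
        (\<sigma> * (LBINT z. std_normal_density z * (\<sigma> * s * G2 z))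
          + 2 * s * \<mu> * (LBINT z. std_normal_density z * G1 z)
          - 2 * s * \<beta> * (LBINT z. std_normal_density z * G z))"
      using int stein by simp
    also have "\<dots> = exp (- \<beta> * s\<^sup>2) * (2 * s) *
        (\<sigma>\<^sup>2 / 2 * (LBINT z. std_normal_density z * G2 z) + \<mu> * (LBINT z. std_normal_density z * G1 z)
          - \<beta> * (LBINT z. std_normal_density z * G z))"
      by (simp add: mult.left_commute[of "std_normal_density _"]) (simp add: algebra_simps power2_eq_square)
    also have "\<dots> = exp (- \<beta> * s\<^sup>2) * (2 * s) *
        (LBINT z. \<sigma>\<^sup>2 / 2 * (std_normal_density z * G2 z) + \<mu> * (std_normal_density z * G1 z)
          - \<beta> * (std_normal_density z * G z))"
      using int by simp
    also have "\<dots> = exp (- \<beta> * s\<^sup>2) * (2 * s) *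
        (LBINT z. std_normal_density z * (\<sigma>\<^sup>2 / 2 * G2 z + \<mu> * G1 z - \<beta> * G z))"
      by (intro arg_cong2[where f="(*)"] refl Bochner_Integration.integral_cong)
        (simp_all add: algebra_simps)
    also have "0 \<le> \<dots>"
      using s subsolution
      by (intro mult_nonneg_nonneg integral_nonneg_AE AE_I2) (auto simp: G_def G1_def G2_def)
    finally show ?thesis .
  qed
  have "0 \<le> (LBINT s. indicator {0..S} s * (LBINT z. std_normal_density z * \<psi> s z))"
    by (intro integral_nonneg_AE AE_I2) (auto simp: indicator_def inner)
  also have "\<dots> = (LBINT z. std_normal_density z * (\<phi> S z - \<phi> 0 z))"
  proof -
    have "(LBINT z. std_normal_density z * (\<phi> S z - \<phi> 0 z))
        = (LBINT z. LBINT s. std_normal_density z * (indicator {0..S} s * \<psi> s z))"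
      by (simp flip: FTC)
    then show ?thesis
      unfolding Fubini[symmetric]
      by (simp add: mult.left_commute[of "std_normal_density _" "indicator _ _"])
  qed
  \<comment> \<open>\<open>Y 0 z\<close> is \<open>p\<close> for every \<open>z\<close>, and the
    Gaussian weight has mass one, so the lower endpoint contributes exactly
    \<open>g p\<close>.\<close>
  also have "\<dots> = exp (- \<beta> * q) * (LBINT z. std_normal_density z * g (Y S z)) - g p"
  proof -
    have "integrable lborel (\<lambda>z. std_normal_density z * g (Y S z))"
      using comp_bound[of S g] S bound(1)
      by (intro integrable_normal_density_exp_growth[where C=C' and k=k']) auto
    moreover have "std_normal_density z * (\<phi> S z - \<phi> 0 z)
        = exp (- \<beta> * q) * (std_normal_density z * g (Y S z)) - g p * std_normal_density z" for z
      by (simp add: \<phi>_def S algebra_simps) (simp add: Y_def)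
    ultimately show ?thesis
      by simp
  qed
  also have "(LBINT z. std_normal_density z * g (Y S z))
      = (LBINT y. normal_density (p + \<mu> * q) (\<sigma> * sqrt q) y * g y)"
    using \<open>0 < q\<close> \<open>0 < \<sigma>\<close> S
    by (subst integral_normal_density_standardize) (auto simp: Y_def S_def)
  finally show ?thesis by simp
qed

section \<open>The time-inconsistent cost dominates \<open>Phi\<close>\<close>

text \<open>Composing the branches with \<open>min\<close> and \<open>max\<close> replaces the case
  distinction by a sum of continuous functions.\<close>

lemma isCont_If_less:
  fixes f g :: "real \<Rightarrow> real"
  assumes "\<And>x. isCont f x" "\<And>x. isCont g x" "f x0 = g x0"
  shows "isCont (\<lambda>x. if x < x0 then f x else g x) x"
proof -
  have "(\<lambda>x. if x < x0 then f x else g x) = (\<lambda>x. f (min x x0) + g (max x x0) - f x0)"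
    using assms(3) by (auto simp: fun_eq_iff min_def max_def)
  then show ?thesis
    by (simp only:) (intro continuous_intros isCont_o2[OF _ assms(1)] isCont_o2[OF _ assms(2)])
qed

lemma DERIV_If_less:
  fixes f g :: "real \<Rightarrow> real"
  assumes f: "\<And>x. (f has_real_derivative f' x) (at x)"
    and g: "\<And>x. (g has_real_derivative g' x) (at x)"
    and eq: "f x0 = g x0" "f' x0 = g' x0"
  shows "((\<lambda>x. if x < x0 then f x else g x) has_real_derivative
    (if x < x0 then f' x else g' x)) (at x)"
proof -
  have "((\<lambda>x. if x \<in> {..<x0} then f x else g x) has_vector_derivative
      (if x \<in> {..<x0} then f' x else g' x)) (at x within UNIV)"
    using f g eq
    by (intro has_vector_derivative_If_within_closures[where T="{x0..}"])
      (auto simp flip: has_real_derivative_iff_has_vector_derivative intro: has_field_derivative_at_within)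
  then show ?thesis
    by (simp add: has_real_derivative_iff_has_vector_derivative)
qed

section \<open>Characteristic roots, smooth fit and the subsolution property\<close>

context outer_problem
begin

text \<open>Squaring the definition shows that \<open>b_exp\<close> is a root of the characteristic
  equation, so \<open>exp (b_exp * y)\<close> is annihilated by the discounted generator.\<close>

lemma b_exp_root: "\<sigma>\<^sup>2 / 2 * b_exp\<^sup>2 + \<mu> * b_exp = \<beta>"
proof -
  have "0 \<le> \<mu>\<^sup>2 + 2 * \<beta> * \<sigma>\<^sup>2"
    using \<beta>_pos by simp
  moreover have "sqrt (\<mu>\<^sup>2 + 2 * \<beta> * \<sigma>\<^sup>2) = \<sigma>\<^sup>2 * b_exp + \<mu>"
    using \<sigma>_pos by (simp add: b_exp_def)
  ultimately have "(\<sigma>\<^sup>2 * b_exp + \<mu>)\<^sup>2 = \<mu>\<^sup>2 + 2 * \<beta> * \<sigma>\<^sup>2"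
    by (metis real_sqrt_pow2)
  then have "\<sigma>\<^sup>2 * (\<sigma>\<^sup>2 / 2 * b_exp\<^sup>2 + \<mu> * b_exp) = \<sigma>\<^sup>2 * \<beta>"
    by (simp add: power2_eq_square algebra_simps)
  then show ?thesis
    using \<sigma>_pos by simp
qed

text \<open>\<open>\<beta>_gt\<close> says that the characteristic polynomial at \<open>a\<close>
  lies below \<open>\<beta>\<close>; completing the square in \<open>a\<close> turns this into a
  comparison with the square root in \<open>b_exp\<close>.\<close>

lemma a_less_b_exp: "a < b_exp"
proof -
  have "\<sigma>\<^sup>2 * (2 * (\<mu> * a + \<sigma>\<^sup>2 * a\<^sup>2 / 2)) < \<sigma>\<^sup>2 * (2 * \<beta>)"
    using \<beta>_gt \<sigma>_pos by (intro mult_strict_left_mono) auto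
  then have "(\<sigma>\<^sup>2 * a + \<mu>)\<^sup>2 < \<mu>\<^sup>2 + 2 * \<beta> * \<sigma>\<^sup>2"
    by (simp add: power2_eq_square algebra_simps)
  then have "\<sigma>\<^sup>2 * a + \<mu> < sqrt (\<mu>\<^sup>2 + 2 * \<beta> * \<sigma>\<^sup>2)"
    by (rule real_less_rsqrt)
  then show ?thesis
    using \<sigma>_pos by (simp add: b_exp_def field_simps)
qed

lemma b_exp_pos: "0 < b_exp"
  using a_less_b_exp a_pos by simp

lemma C_a_pos: "0 < C_a"
  using \<beta>_gt by (simp add: C_a_def)

text \<open>The definition of \<open>x_hat\<close> solved for the exponential. The argument of the
  logarithm is positive because \<open>a < b_exp\<close>; later computations use only this algebraic
  form.\<close>

lemma C_a_exp_x_hat: "a * (b_exp - a) * (C_a * exp (a * x_hat)) = b_exp * c"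
proof -
  let ?d = "\<beta> - \<mu> * a - \<sigma>\<^sup>2 * a\<^sup>2 / 2"
  let ?k = "a * (b_exp - a)"
  have d: "0 < ?d" and k: "0 < ?k" and eq: "b_exp * a - a\<^sup>2 = ?k"
    using \<beta>_gt a_pos a_less_b_exp by (simp_all add: power2_eq_square algebra_simps)
  have "0 < b_exp * c * ?d / ?k"
    using d k b_exp_pos c_pos by (intro divide_pos_pos mult_pos_pos[of "b_exp * c"]) simp_all
  then have "exp (a * x_hat) = b_exp * c * ?d / ?k"
    unfolding x_hat_def eq using a_pos by (simp del: zero_less_divide_iff zero_less_mult_iff)
  moreover have "C_a = 1 / ?d"
    by (simp add: C_a_def)
  moreover have "k * (1 / d * (x * d / k)) = x" if "0 < d" "0 < k" for d k x :: real
    using that by simp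
  ultimately show ?thesis
    using d k by presburger
qed

text \<open>The factor \<open>exp ((a - b_exp) * x_hat)\<close> in \<open>C_b\<close> is there for
  this cancellation, which is the second-order fit in disguise.\<close>

lemma C_b_exp_x_hat: "C_b * exp (b_exp * x_hat) = - (a\<^sup>2 / b_exp\<^sup>2) * (C_a * exp (a * x_hat))"
  by (simp add: C_b_def left_diff_distrib flip: exp_add)

text \<open>The integrand of \<open>Psi\<close>.  The smooth fit of \<open>Phi\<close> at \<open>x_hat\<close> holds up to the second
  derivative, so it is \<open>C\<^sup>2\<close>, and it is a subsolution of the discounted generator.\<close>

definition gap :: "real \<Rightarrow> real" where
  "gap y = Phi y - C_a * exp (a * y)"

definition gap' :: "real \<Rightarrow> real" where
  "gap' y = (if y < x_hat then C_b * b_exp * exp (b_exp * y) else c - C_a * a * exp (a * y))"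

definition gap'' :: "real \<Rightarrow> real" where
  "gap'' y = (if y < x_hat then C_b * b_exp\<^sup>2 * exp (b_exp * y) else - C_a * a\<^sup>2 * exp (a * y))"

definition Phi_x_hat :: real where
  "Phi_x_hat = C_a * exp (a * x_hat) + C_b * exp (b_exp * x_hat)"

lemma gap_eq:
  "gap y = (if y < x_hat then C_b * exp (b_exp * y)
    else c * (y - x_hat) + Phi_x_hat - C_a * exp (a * y))"
  by (simp add: gap_def Phi_def Phi_x_hat_def)

text \<open>Once \<open>C_b\<close> is tied to the second-order fit, equality of slopes is the
  equation that determines \<open>x_hat\<close>: multiplied by \<open>b_exp\<close> it becomes
  \<open>C_a_exp_x_hat\<close>.\<close>

lemma first_order_fit: "C_b * b_exp * exp (b_exp * x_hat) = c - C_a * a * exp (a * x_hat)"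
proof -
  have "b_exp * (C_b * b_exp * exp (b_exp * x_hat)) = b_exp\<^sup>2 * (C_b * exp (b_exp * x_hat))"
    by (simp add: power2_eq_square)
  also have "\<dots> = - a\<^sup>2 * (C_a * exp (a * x_hat))"
    using b_exp_pos by (simp add: C_b_exp_x_hat)
  also have "\<dots> = b_exp * c - b_exp * (C_a * a * exp (a * x_hat))"
    using C_a_exp_x_hat by (simp add: algebra_simps power2_eq_square)
  finally show ?thesis
    using b_exp_pos by (simp flip: right_diff_distrib)
qed

lemma second_order_fit: "C_b * b_exp\<^sup>2 * exp (b_exp * x_hat) = - C_a * a\<^sup>2 * exp (a * x_hat)"
  using C_b_exp_x_hat b_exp_pos by (simp add: field_simps)

lemma DERIV_gap: "(gap has_real_derivative gap' y) (at y)"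
  unfolding gap_eq[abs_def] gap'_def
  by (rule DERIV_If_less)
    (auto intro!: derivative_eq_intros simp: Phi_x_hat_def first_order_fit)

lemma DERIV_gap': "(gap' has_real_derivative gap'' y) (at y)"
  unfolding gap'_def[abs_def] gap''_def
  by (rule DERIV_If_less)
    (auto intro!: derivative_eq_intros simp: first_order_fit second_order_fit[unfolded power2_eq_square] power2_eq_square)

lemma isCont_gap'': "isCont gap'' y"
  unfolding gap''_def[abs_def]
  by (rule isCont_If_less) (auto intro!: continuous_intros simp: second_order_fit)

lemma gap_measurable [measurable]: "gap \<in> borel_measurable borel"
  unfolding gap_eq[abs_def] by measurable

lemma gap_growth:
  obtains C k where "0 \<le> k" "\<And>y. \<bar>gap y\<bar> \<le> C * exp (k * \<bar>y\<bar>)"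
    "\<And>y. \<bar>gap' y\<bar> \<le> C * exp (k * \<bar>y\<bar>)" "\<And>y. \<bar>gap'' y\<bar> \<le> C * exp (k * \<bar>y\<bar>)"
proof -
  \<comment> \<open>Exceeds both exponents, and the summand 1 lets the exponential also dominate the
    linear term.\<close>
  define k where "k = 1 + a + b_exp"
  define C where "C = \<bar>C_b\<bar> * (1 + b_exp + b_exp\<^sup>2) + C_a * (1 + a + a\<^sup>2) + c * (1 + \<bar>x_hat\<bar>) + \<bar>Phi_x_hat\<bar>"
  have main: "\<bar>gap y\<bar> \<le> C * exp (k * \<bar>y\<bar>) \<and> \<bar>gap' y\<bar> \<le> C * exp (k * \<bar>y\<bar>)
      \<and> \<bar>gap'' y\<bar> \<le> C * exp (k * \<bar>y\<bar>)" for y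
  proof -
    let ?E = "exp (k * \<bar>y\<bar>)"
    have "l * y \<le> k * \<bar>y\<bar>" if "0 \<le> l" "l \<le> k" for l
      using that mult_mono[of l k "\<bar>y\<bar>" "\<bar>y\<bar>"] mult_left_mono[OF abs_ge_self[of y], of l] by simp
    then have exps: "exp (a * y) \<le> ?E" "exp (b_exp * y) \<le> ?E"
      using a_pos b_exp_pos by (simp_all add: k_def)
    have "1 * \<bar>y\<bar> \<le> k * \<bar>y\<bar>"
      using a_pos b_exp_pos by (intro mult_right_mono) (auto simp: k_def)
    then have E: "\<bar>y\<bar> \<le> ?E" "1 \<le> ?E"
      using exp_ge_add_one_self[of "k * \<bar>y\<bar>"] by linarith+
    \<comment> \<open>\<open>N d\<close> is the allowance for a term with coefficient
      \<open>d\<close>. \<open>C * ?E\<close> is the sum of nine allowances, and each branch of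
      \<open>gap\<close>, \<open>gap'\<close> and \<open>gap''\<close> uses some of them.\<close>
    define N where "N d = \<bar>d\<bar> * ?E" for d
    have lift: "\<bar>d * e\<bar> \<le> N d" if "\<bar>e\<bar> \<le> ?E" for d e
      unfolding N_def abs_mult using that by (intro mult_left_mono) auto
    have terms: "\<bar>d * exp (a * y)\<bar> \<le> N d" "\<bar>d * exp (b_exp * y)\<bar> \<le> N d"
        "\<bar>d * y\<bar> \<le> N d" "\<bar>d * 1\<bar> \<le> N d" for d
      by (rule lift; use exps E in simp)+
    have terms5: "0 \<le> N d" for d
      by (simp add: N_def)
    have sum: "C * ?E = N C_b + N (C_b * b_exp) + N (C_b * b_exp\<^sup>2)
        + N C_a + N (C_a * a) + N (C_a * a\<^sup>2) + N c + N (c * x_hat) + N Phi_x_hat"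
      using a_pos b_exp_pos C_a_pos c_pos by (simp add: C_def N_def abs_mult algebra_simps)
    note nonneg = terms5[of C_b] terms5[of "C_b * b_exp"] terms5[of "C_b * b_exp\<^sup>2"]
      terms5[of C_a] terms5[of "C_a * a"] terms5[of "C_a * a\<^sup>2"] terms5[of c]
      terms5[of "c * x_hat"] terms5[of Phi_x_hat]
    have "\<bar>gap y\<bar> \<le> C * ?E"
    proof (cases "y < x_hat")
      case True
      then have "gap y = C_b * exp (b_exp * y)"
        by (simp add: gap_eq)
      then show ?thesis
        unfolding sum using nonneg terms(2)[of C_b] by linarith
    next
      case False
      then have "gap y = c * y - c * x_hat + Phi_x_hat - C_a * exp (a * y)"
        by (simp add: gap_eq right_diff_distrib)
      then show ?thesis
        unfolding sum
        using nonneg terms(3)[of c] terms(4)[of "c * x_hat", unfolded mult_1_right]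
          terms(4)[of Phi_x_hat, unfolded mult_1_right] terms(1)[of C_a]
        by linarith
    qed
    moreover have "\<bar>gap' y\<bar> \<le> C * ?E"
      unfolding sum gap'_def
      using nonneg terms(2)[of "C_b * b_exp"] terms(4)[of c, unfolded mult_1_right] terms(1)[of "C_a * a"]
      by (cases "y < x_hat"; simp only: if_True if_False; linarith)
    moreover have "\<bar>gap'' y\<bar> \<le> C * ?E"
      unfolding sum gap''_def
      using nonneg terms(2)[of "C_b * b_exp\<^sup>2"] terms(1)[of "C_a * a\<^sup>2"]
      by (cases "y < x_hat"; simp only: if_True if_False mult_minus_left abs_minus_cancel; linarith)
    ultimately show ?thesis by blast
  qed
  have "0 \<le> k"
    using a_pos b_exp_pos by (simp add: k_def)
  with main show thesis
    by (intro that) auto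
qed

lemma gap_subsolution: "0 \<le> \<sigma>\<^sup>2 / 2 * gap'' y + \<mu> * gap' y - \<beta> * gap y"
proof (cases "y < x_hat")
  case True
  then have "\<sigma>\<^sup>2 / 2 * gap'' y + \<mu> * gap' y - \<beta> * gap y
      = C_b * exp (b_exp * y) * (\<sigma>\<^sup>2 / 2 * b_exp\<^sup>2 + \<mu> * b_exp - \<beta>)"
    by (simp add: gap''_def gap'_def gap_eq algebra_simps)
  then show ?thesis
    using b_exp_root by simp
next
  case False
  define d where "d = \<beta> - \<mu> * a - \<sigma>\<^sup>2 * a\<^sup>2 / 2"
  have C_a_d: "C_a * d = 1"
    using \<beta>_gt by (simp add: C_a_def d_def)
  \<comment> \<open>The characteristic polynomial at \<open>b_exp\<close> minus its value at
    \<open>a\<close>, factored; this makes \<open>d\<close> cancel against \<open>b_exp - a\<close>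
    in \<open>C_a_exp_x_hat\<close>.\<close>
  have "(b_exp - a) * (\<sigma>\<^sup>2 / 2 * (a + b_exp) + \<mu>)
      = (\<sigma>\<^sup>2 / 2 * b_exp\<^sup>2 + \<mu> * b_exp) - \<mu> * a - \<sigma>\<^sup>2 * a\<^sup>2 / 2"
    by (simp add: field_simps power2_eq_square)
  then have "d = (b_exp - a) * (\<sigma>\<^sup>2 / 2 * (a + b_exp) + \<mu>)"
    unfolding b_exp_root d_def by simp
  then have "a * (C_a * d * exp (a * x_hat))
      = a * (b_exp - a) * (C_a * exp (a * x_hat)) * (\<sigma>\<^sup>2 / 2 * (a + b_exp) + \<mu>)"
    by (simp add: mult_ac)
  also have "\<dots> = c * (\<sigma>\<^sup>2 / 2 * b_exp\<^sup>2 + \<mu> * b_exp + \<sigma>\<^sup>2 / 2 * (a * b_exp))"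
    unfolding C_a_exp_x_hat by (simp add: algebra_simps power2_eq_square)
  \<comment> \<open>The tangent slope exceeds \<open>\<beta> * c\<close>, the rate at which
    discounting the affine part of \<open>gap\<close> grows.\<close>
  finally have slope: "a * exp (a * x_hat) = c * (\<beta> + \<sigma>\<^sup>2 / 2 * (a * b_exp))"
    unfolding b_exp_root C_a_d by simp
  have "a * b_exp * Phi_x_hat = a * b_exp * (1 - a\<^sup>2 / b_exp\<^sup>2) * (C_a * exp (a * x_hat))"
    by (simp add: Phi_x_hat_def C_b_exp_x_hat algebra_simps)
  also have "\<dots> = (a + b_exp) / b_exp * (a * (b_exp - a) * (C_a * exp (a * x_hat)))"
    using b_exp_pos by (simp add: field_simps power2_eq_square)
  also have "\<dots> = (a + b_exp) * c"
    unfolding C_a_exp_x_hat using b_exp_pos by simp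
  finally have fit: "a * b_exp * Phi_x_hat = (a + b_exp) * c" .
  have "a * b_exp * (exp (a * x_hat) + \<mu> * c - \<beta> * Phi_x_hat)
      = b_exp * (a * exp (a * x_hat)) + \<mu> * c * a * b_exp - \<beta> * (a * b_exp * Phi_x_hat)"
    by (simp add: algebra_simps)
  also have "\<dots> = a * c * (\<sigma>\<^sup>2 / 2 * b_exp\<^sup>2 + \<mu> * b_exp - \<beta>)"
    unfolding slope fit by (simp add: algebra_simps power2_eq_square)
  \<comment> \<open>The discounted generator of \<open>gap\<close> vanishes at \<open>x_hat\<close>,
    as the identity on the left and the continuity of \<open>gap''\<close> predict.\<close>
  finally have val: "exp (a * x_hat) + \<mu> * c - \<beta> * Phi_x_hat = 0"
    unfolding b_exp_root using a_pos b_exp_pos by simp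
  have "\<sigma>\<^sup>2 / 2 * gap'' y + \<mu> * gap' y - \<beta> * gap y
      = C_a * d * exp (a * y) + \<mu> * c - \<beta> * (c * (y - x_hat) + Phi_x_hat)"
    using False by (simp add: gap''_def gap'_def gap_eq d_def algebra_simps)
  also have "\<dots> = exp (a * x_hat) * exp (a * (y - x_hat)) + \<mu> * c - \<beta> * (c * (y - x_hat) + Phi_x_hat)"
    by (simp add: C_a_d right_diff_distrib flip: exp_add)
  \<comment> \<open>The exponential is replaced by its tangent at \<open>x_hat\<close>; what remains
    is affine in \<open>y - x_hat\<close>.\<close>
  also have "\<dots> \<ge> exp (a * x_hat) * (1 + a * (y - x_hat)) + \<mu> * c - \<beta> * (c * (y - x_hat) + Phi_x_hat)"
    using mult_left_mono[OF exp_ge_add_one_self[of "a * (y - x_hat)"], of "exp (a * x_hat)"] by simp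
  also have "exp (a * x_hat) * (1 + a * (y - x_hat)) + \<mu> * c - \<beta> * (c * (y - x_hat) + Phi_x_hat)
      = (y - x_hat) * (a * exp (a * x_hat) - \<beta> * c) + (exp (a * x_hat) + \<mu> * c - \<beta> * Phi_x_hat)"
    by (simp add: algebra_simps)
  also have "\<dots> = (y - x_hat) * (c * (\<sigma>\<^sup>2 / 2 * (a * b_exp)))"
    unfolding slope val by (simp add: algebra_simps)
  also have "\<dots> \<ge> 0"
    using False a_pos b_exp_pos c_pos by simp
  finally show ?thesis by simp
qed

section \<open>Bounds for \<open>Psi\<close>\<close>

lemma Phi_le_Psi:
  assumes "0 \<le> q"
  shows "Phi p \<le> Psi p q"
proof (cases "q = 0")
  case False
  then have "0 < q" using assms by simp
  obtain C k where "0 \<le> k" "\<And>y. \<bar>gap y\<bar> \<le> C * exp (k * \<bar>y\<bar>)"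
    "\<And>y. \<bar>gap' y\<bar> \<le> C * exp (k * \<bar>y\<bar>)" "\<And>y. \<bar>gap'' y\<bar> \<le> C * exp (k * \<bar>y\<bar>)"
    by (rule gap_growth) (rule that; assumption)
  \<comment> \<open>\<open>Phi p\<close> and \<open>Psi p q\<close> share the summand
    \<open>C_a * exp (a * p)\<close>, so comparing them is comparing \<open>gap p\<close> with its
    discounted expectation.\<close>
  then have "gap p \<le> exp (- \<beta> * q) * (LBINT y. normal_density (p + \<mu> * q) (\<sigma> * sqrt q) y * gap y)"
    using \<sigma>_pos \<beta>_pos \<open>0 < q\<close>
    by (intro discounted_normal_expectation_ge[OF DERIV_gap DERIV_gap' isCont_gap'' _ _ _ _ gap_subsolution])
      auto
  with \<open>0 < q\<close> show ?thesis
    by (simp add: Psi_def gap_def)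
qed (simp add: Psi_def)

text \<open>The exponent must be \<open>a\<close>: its Gaussian moment grows more slowly than the
  discount decays, whereas the larger rate in \<open>gap_growth\<close> gives no bound uniform in
  time. It suffices because \<open>gap\<close> is nonpositive left of \<open>x_hat\<close> and at
  most affine to the right.\<close>

lemma gap_le_exp:
  obtains K where "0 \<le> K" "\<And>y. gap y \<le> K * exp (a * y)"
proof
  \<comment> \<open>With \<open>u = a * (y - x_hat)\<close> the affine part is
    \<open>c / a * u + Phi_x_hat\<close>; both \<open>u\<close> and 1 are at most
    \<open>exp u\<close>, and \<open>exp (- a * x_hat)\<close> undoes the shift.\<close>
  let ?K = "(c / a + \<bar>Phi_x_hat\<bar>) * exp (- a * x_hat)"
  show "0 \<le> ?K"
    using a_pos c_pos by simp
  show "gap y \<le> ?K * exp (a * y)" for y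
  proof (cases "y < x_hat")
    case True
    have "C_b \<le> 0"
      using C_a_pos by (simp add: C_b_def)
    with True have "gap y \<le> 0"
      by (simp add: gap_eq mult_nonpos_nonneg)
    also have "0 \<le> ?K * exp (a * y)"
      using \<open>0 \<le> ?K\<close> by (rule mult_nonneg_nonneg) simp
    finally show ?thesis .
  next
    case False
    let ?u = "a * (y - x_hat)"
    have "gap y \<le> c / a * ?u + \<bar>Phi_x_hat\<bar> * 1"
    proof -
      have "0 \<le> C_a * exp (a * y)" "c / a * ?u = c * (y - x_hat)"
        using a_pos C_a_pos by simp_all
      with False show ?thesis
        unfolding gap_eq by (simp only: if_False)
    qed
    also have "\<dots> \<le> c / a * exp ?u + \<bar>Phi_x_hat\<bar> * exp ?u"
    proof -
      have "0 \<le> ?u"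
        using False a_pos by simp
      then have "?u \<le> exp ?u" "1 \<le> exp ?u"
        using exp_ge_add_one_self[of ?u] by linarith+
      then show ?thesis
        using a_pos c_pos by (intro add_mono mult_left_mono) simp_all
    qed
    also have "exp ?u = exp (- a * x_hat) * exp (a * y)"
      by (simp add: right_diff_distrib flip: exp_add)
    also have "c / a * (exp (- a * x_hat) * exp (a * y))
        + \<bar>Phi_x_hat\<bar> * (exp (- a * x_hat) * exp (a * y)) = ?K * exp (a * y)"
      by (simp only: distrib_right mult.assoc)
    finally show ?thesis .
  qed
qed

lemma Psi_bounded_above:
  obtains K where "\<And>q. 0 \<le> q \<Longrightarrow> Psi p q \<le> K"
proof -
  obtain K where K: "0 \<le> K" "\<And>y. gap y \<le> K * exp (a * y)"
    by (rule gap_le_exp) (rule that; assumption)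
  obtain C k where growth: "\<And>y. \<bar>gap y\<bar> \<le> C * exp (k * \<bar>y\<bar>)"
    by (rule gap_growth) (rule that)
  have "Psi p q \<le> (C_a + K) * exp (a * p)" if "0 \<le> q" for q
  proof (cases "q = 0")
    case True
    then show ?thesis
      using K(2)[of p] by (simp add: Psi_def gap_def algebra_simps)
  next
    case False
    define m s where "m = p + \<mu> * q" and "s = \<sigma> * sqrt q"
    have q: "0 < q" "0 < s" "s\<^sup>2 = \<sigma>\<^sup>2 * q"
      using that False \<sigma>_pos by (simp_all add: s_def power_mult_distrib)
    have "(LBINT y. normal_density m s y * gap y) \<le> (LBINT y. K * (normal_density m s y * exp (a * y)))"
    proof (rule integral_mono)
      show "normal_density m s y * gap y \<le> K * (normal_density m s y * exp (a * y))" for y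
        using mult_left_mono[OF K(2)[of y] normal_density_nonneg[of m s y]] by (simp add: mult_ac)
    qed (use growth q in \<open>auto intro!: integrable_normal_density_exp_growth integral_normal_density_exp\<close>)
    also have "\<dots> = K * exp (a * m + a\<^sup>2 * s\<^sup>2 / 2)"
      by (simp add: integral_normal_density_exp[OF q(2)])
    finally have "exp (- \<beta> * q) * (LBINT y. normal_density m s y * gap y)
        \<le> exp (- \<beta> * q) * (K * exp (a * m + a\<^sup>2 * s\<^sup>2 / 2))"
      by (rule mult_left_mono) simp
    \<comment> \<open>Discount and Gaussian moment combine to a decay rate that
      \<open>\<beta>_gt\<close> makes positive.\<close>
    also have "\<dots> = K * exp (a * p + - (\<beta> - \<mu> * a - \<sigma>\<^sup>2 * a\<^sup>2 / 2) * q)"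
      by (simp add: q(3) m_def mult.left_commute[of _ K] flip: exp_add) (simp add: algebra_simps)
    also have "\<dots> \<le> K * exp (a * p)"
    proof -
      have "0 \<le> (\<beta> - \<mu> * a - \<sigma>\<^sup>2 * a\<^sup>2 / 2) * q"
        using \<beta>_gt q by (intro mult_nonneg_nonneg) auto
      then have "exp (a * p + - (\<beta> - \<mu> * a - \<sigma>\<^sup>2 * a\<^sup>2 / 2) * q) \<le> exp (a * p)"
        unfolding exp_le_cancel_iff by linarith
      then show ?thesis
        using K(1) by (rule mult_left_mono)
    qed
    finally show ?thesis
      using q by (simp add: Psi_def m_def s_def gap_def algebra_simps)
  qed
  then show thesis by (rule that)
qed

lemma Psi_measurable [measurable]: "Psi p \<in> borel_measurable borel"
proof -
  have "(\<lambda>q. LBINT y. normal_density (p + \<mu> * q) (\<sigma> * sqrt q) y * gap y) \<in> borel_measurable borel"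
    unfolding normal_density_def by measurable
  then show ?thesis
    unfolding Psi_def[abs_def] gap_def[symmetric] by measurable
qed

end

section \<open>Costs of control paths\<close>

lemma emeasure_interval_measure_Ioi:
  assumes mono: "mono G" and cont: "\<And>r. continuous (at_right r) G" and lim: "(G \<longlongrightarrow> L) at_top"
  shows "emeasure (interval_measure G) {u<..} = L - G u"
proof (rule LIMSEQ_unique)
  have "(\<lambda>n. emeasure (interval_measure G) {u<..u + real n}) \<longlonglongrightarrow>
      emeasure (interval_measure G) (\<Union>n. {u<..u + real n})"
    by (intro Lim_emeasure_incseq) (auto simp: incseq_def)
  also have "(\<Union>n. {u<..u + real n}) = {u<..}"
  proof (intro equalityI subsetI)
    fix r assume "r \<in> {u<..}"
    moreover obtain n :: nat where "r - u \<le> real n"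
      using real_arch_simple by blast
    ultimately have "r \<in> {u<..u + real n}"
      by simp
    then show "r \<in> (\<Union>n. {u<..u + real n})"
      by blast
  qed auto
  finally show "(\<lambda>n. emeasure (interval_measure G) {u<..u + real n}) \<longlonglongrightarrow>
      emeasure (interval_measure G) {u<..}" .
  have "filterlim (\<lambda>n. u + real n) at_top sequentially"
    by real_asymp
  then have "(\<lambda>n. G (u + real n) - G u) \<longlonglongrightarrow> L - G u"
    by (intro tendsto_diff tendsto_const filterlim_compose[OF lim])
  then show "(\<lambda>n. emeasure (interval_measure G) {u<..u + real n}) \<longlonglongrightarrow> ennreal (L - G u)"
    using mono cont by (simp add: emeasure_interval_measure_Ioc monoD)
qed

text \<open>The paths of the elements of \<open>controls t z\<close>, off a null set.\<close>

definition control_path :: "real \<Rightarrow> real \<Rightarrow> (real \<Rightarrow> real) \<Rightarrow> bool" where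
  "control_path t z G \<longleftrightarrow> mono G \<and> (\<forall>r. continuous (at_right r) G) \<and> (\<forall>r<t. G r = z) \<and>
     (G \<longlongrightarrow> 1) at_top"

lemma control_path_le_1:
  assumes "control_path t z G"
  shows "G r \<le> 1"
proof (rule tendsto_lowerbound)
  show "(G \<longlongrightarrow> 1) at_top"
    using assms by (simp add: control_path_def)
  show "\<forall>\<^sub>F s in at_top. G r \<le> G s"
    using assms by (auto simp: control_path_def eventually_at_top_linorder dest: monoD)
qed simp

lemma control_path_ge:
  assumes "control_path t z G"
  shows "z \<le> G r"
proof -
  have "mono G" "G (min r (t - 1)) = z"
    using assms by (simp_all add: control_path_def)
  moreover from \<open>mono G\<close> have "G (min r (t - 1)) \<le> G r"
    by (rule monoD) simp
  ultimately show ?thesis by simp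
qed

text \<open>This path serves twice: as the competitor in the equilibrium condition and as a
  replacement for paths in a null set.\<close>

lemma control_path_jump:
  assumes "z \<le> 1"
  shows "control_path t z (\<lambda>r. if r < t then z else 1)"
proof -
  have "((\<lambda>r. if r < t then z else 1) \<longlongrightarrow> (if r < t then z else 1)) (at_right r)" for r
  proof (rule tendsto_eventually)
    show "\<forall>\<^sub>F s in at_right r. (if s < t then z else 1) = (if r < t then z else 1)"
    proof (cases "r < t")
      case True
      then show ?thesis
        by (auto simp: eventually_at_right[of r t] intro: exI[of _ t])
    next
      case False
      then show ?thesis
        by (auto simp: eventually_at_right[of r "r + 1"] intro: exI[of _ "r + 1"])
    qed
  qed
  moreover have "((\<lambda>r. if r < t then z else 1) \<longlongrightarrow> 1) at_top"
    by (intro tendsto_eventually) (auto simp: eventually_at_top_linorder intro: exI[of _ t])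
  ultimately show ?thesis
    using assms by (auto simp: control_path_def mono_def continuous_within)
qed

text \<open>Half-lines starting before \<open>t\<close> all have mass \<open>1 - z\<close>, as
  \<open>G\<close> is constant there. Letting them exhaust the line, or shrink to
  \<open>{t..}\<close>, gives both claims; the atom at \<open>t\<close> is included.\<close>

lemma emeasure_control_path:
  assumes G: "control_path t z G"
  shows emeasure_control_path_UNIV: "emeasure (interval_measure G) UNIV = 1 - z"
    and emeasure_control_path_Ici: "emeasure (interval_measure G) {t..} = 1 - z"
proof -
  let ?m = "interval_measure G"
  have Ioi: "emeasure ?m {u<..} = ennreal (1 - G u)" for u
    using G by (intro emeasure_interval_measure_Ioi) (auto simp: control_path_def)
  have eq: "G u = z" if "u < t" for u
    using G that by (simp add: control_path_def)
  have "(\<lambda>n. emeasure ?m {t - 1 - real n<..}) \<longlonglongrightarrow> emeasure ?m (\<Union>n. {t - 1 - real n<..})"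
    by (intro Lim_emeasure_incseq) (auto simp: incseq_def)
  moreover have "(\<Union>n. {t - 1 - real n<..}) = UNIV"
  proof (intro equalityI subsetI)
    fix r :: real
    obtain n :: nat where "t - 1 - r < real n"
      using reals_Archimedean2 by blast
    then have "r \<in> {t - 1 - real n<..}"
      by simp
    then show "r \<in> (\<Union>n. {t - 1 - real n<..})"
      by blast
  qed simp
  ultimately show "emeasure ?m UNIV = ennreal (1 - z)"
    by (simp add: Ioi eq LIMSEQ_const_iff)
  have "(\<lambda>n. emeasure ?m {t - inverse (Suc n)<..}) \<longlonglongrightarrow> emeasure ?m (\<Inter>n. {t - inverse (Suc n)<..})"
    by (intro Lim_emeasure_decseq) (auto simp: decseq_def Ioi frac_le inverse_eq_divide)
  moreover have "(\<Inter>n. {t - inverse (Suc n)<..}) = {t..}"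
  proof (intro equalityI subsetI)
    fix r assume r: "r \<in> (\<Inter>n. {t - inverse (Suc n)<..})"
    show "r \<in> {t..}"
    proof (rule ccontr)
      assume "r \<notin> {t..}"
      then obtain n where "inverse (real (Suc n)) < t - r"
        using reals_Archimedean[of "t - r"] by auto
      with r show False
        by (auto dest!: spec[of _ n])
    qed
  qed (auto intro: less_le_trans[of _ t])
  ultimately show "emeasure ?m {t..} = ennreal (1 - z)"
    by (simp add: Ioi eq LIMSEQ_const_iff)
qed

text \<open>Each estimate uses both bounds: together they make \<open>f\<close> integrable against
  the finite Stieltjes measure, which monotonicity of the integral presupposes.\<close>

lemma set_integral_control_path_bounds:
  fixes f :: "real \<Rightarrow> real"
  assumes G: "control_path t z G" and [measurable]: "f \<in> borel_measurable borel" and "z \<le> 1"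
    and bounds: "\<And>r. t \<le> r \<Longrightarrow> A \<le> f r" "\<And>r. t \<le> r \<Longrightarrow> f r \<le> B"
  shows "A * (1 - z) \<le> (LINT r:{t..}|interval_measure G. f r)"
    and "(LINT r:{t..}|interval_measure G. f r) \<le> B * (1 - z)"
proof -
  let ?m = "interval_measure G"
  interpret finite_measure ?m
    using emeasure_control_path_UNIV[OF G] by (intro finite_measureI) simp
  have mass: "measure ?m {t..} = 1 - z"
    using emeasure_control_path_Ici[OF G] \<open>z \<le> 1\<close> by (simp add: measure_def)
  have ind: "set_integrable ?m {t..} (\<lambda>_. k)" for k :: real
    unfolding set_integrable_def by (intro integrable_scaleR_left integrable_real_indicator)
      (auto simp: emeasure_eq_measure)
  have int: "set_integrable ?m {t..} f"
    unfolding set_integrable_def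
  proof (rule integrable_const_bound)
    show "AE r in ?m. norm (indicator {t..} r *\<^sub>R f r) \<le> \<bar>A\<bar> + \<bar>B\<bar>"
      using bounds by (intro AE_I2) (force simp: indicator_def)
  qed measurable
  have const: "(LINT r:{t..}|?m. k) = k * (1 - z)" for k
    by (simp add: set_lebesgue_integral_def mass mult.commute)
  show "A * (1 - z) \<le> (LINT r:{t..}|?m. f r)"
    unfolding const[symmetric] by (intro set_integral_mono ind int) (use bounds in auto)
  show "(LINT r:{t..}|?m. f r) \<le> B * (1 - z)"
    unfolding const[symmetric] by (intro set_integral_mono ind int) (use bounds in auto)
qed

lemma set_integral_exp_discount:
  fixes \<beta> t :: real
  assumes "0 < \<beta>"
  shows "set_integrable lborel {t..} (\<lambda>r::real. exp (- \<beta> * (r - t)))"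
    and "(LINT r:{t..}|lborel. exp (- \<beta> * (r - t))) = 1 / \<beta>"
proof -
  have "(\<integral>\<^sup>+r. ennreal (exp (- \<beta> * (r - t))) * indicator {t..} r \<partial>lborel)
      = ennreal (0 - (- exp (- \<beta> * (t - t)) / \<beta>))"
  proof (rule nn_integral_FTC_atLeast[where F="\<lambda>r. - exp (- \<beta> * (r - t)) / \<beta>"])
    show "((\<lambda>r. - exp (- \<beta> * (r - t)) / \<beta>) has_real_derivative exp (- \<beta> * (r - t))) (at r)" for r
      using assms by (auto intro!: derivative_eq_intros)
    show "((\<lambda>r. - exp (- \<beta> * (r - t)) / \<beta>) \<longlongrightarrow> 0) at_top"
      using assms by real_asymp
  qed auto
  then have "(\<integral>\<^sup>+r. ennreal (indicator {t..} r * exp (- \<beta> * (r - t))) \<partial>lborel) = ennreal (1 / \<beta>)"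
    by (simp add: ennreal_mult' ennreal_indicator mult.commute)
  then have "has_bochner_integral lborel (\<lambda>r. indicator {t..} r * exp (- \<beta> * (r - t))) (1 / \<beta>)"
    using assms by (intro has_bochner_integral_nn_integral) auto
  then show "set_integrable lborel {t..} (\<lambda>r::real. exp (- \<beta> * (r - t)))"
    and "(LINT r:{t..}|lborel. exp (- \<beta> * (r - t))) = 1 / \<beta>"
    by (auto simp: set_integrable_def set_lebesgue_integral_def has_bochner_integral_iff)
qed

lemma discounted_integral_bounds:
  fixes f :: "real \<Rightarrow> real"
  assumes "0 < \<beta>" and [measurable]: "f \<in> borel_measurable borel"
    and bounds: "\<And>r. t \<le> r \<Longrightarrow> A \<le> f r" "\<And>r. t \<le> r \<Longrightarrow> f r \<le> B"
  shows "A / \<beta> \<le> (LINT r:{t..}|lborel. exp (- \<beta> * (r - t)) * f r)"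
    and "(LINT r:{t..}|lborel. exp (- \<beta> * (r - t)) * f r) \<le> B / \<beta>"
proof -
  note exp_int = set_integral_exp_discount[OF \<open>0 < \<beta>\<close>, of t]
  have cint: "set_integrable lborel {t..} (\<lambda>r. exp (- \<beta> * (r - t)) * k)"
    and cval: "(LINT r:{t..}|lborel. exp (- \<beta> * (r - t)) * k) = k / \<beta>" for k
    using exp_int by (simp_all del: mult_minus_left)
  have int: "set_integrable lborel {t..} (\<lambda>r. exp (- \<beta> * (r - t)) * f r)"
    unfolding set_integrable_def
  proof (rule Bochner_Integration.integrable_bound)
    show "integrable lborel (\<lambda>r. indicator {t..} r *\<^sub>R (exp (- \<beta> * (r - t)) * (\<bar>A\<bar> + \<bar>B\<bar>)))"
      using cint unfolding set_integrable_def .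
    show "AE r in lborel. norm (indicator {t..} r *\<^sub>R (exp (- \<beta> * (r - t)) * f r))
        \<le> norm (indicator {t..} r *\<^sub>R (exp (- \<beta> * (r - t)) * (\<bar>A\<bar> + \<bar>B\<bar>)))"
      using bounds by (intro AE_I2) (force simp: indicator_def abs_mult intro!: mult_left_mono)
  qed measurable
  show "A / \<beta> \<le> (LINT r:{t..}|lborel. exp (- \<beta> * (r - t)) * f r)"
    unfolding cval[symmetric] by (intro set_integral_mono cint int) (use bounds in auto)
  show "(LINT r:{t..}|lborel. exp (- \<beta> * (r - t)) * f r) \<le> B / \<beta>"
    unfolding cval[symmetric] by (intro set_integral_mono cint int) (use bounds in auto)
qed

text \<open>Viewing the Stieltjes measure as a kernel makes integration against it measurable in
  \<open>\<omega>\<close>. Half-open intervals form an intersection-stable generator on which the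
  mass is an increment of \<open>\<eta>\<close>.\<close>

lemma measurable_interval_measure_control_path:
  assumes [measurable]: "\<And>r. \<eta> r \<in> borel_measurable M"
    and path: "\<And>\<omega>. \<omega> \<in> space M \<Longrightarrow> control_path t z (\<lambda>r. \<eta> r \<omega>)" and "0 \<le> z"
  shows "(\<lambda>\<omega>. interval_measure (\<lambda>r. \<eta> r \<omega>)) \<in> measurable M (subprob_algebra borel)"
proof (rule measurable_subprob_algebra_generated[where \<Omega>=UNIV and G="range (\<lambda>(a, b). {a<..b::real})"])
  show "sets borel = sigma_sets UNIV (range (\<lambda>(a, b). {a<..b::real}))"
    by (subst borel_sigma_sets_Ioc) simp
  show "Int_stable (range (\<lambda>(a, b). {a<..b::real}))"
    by (auto simp: Int_stable_def)
  show "subprob_space (interval_measure (\<lambda>r. \<eta> r \<omega>))" if "\<omega> \<in> space M" for \<omega>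
    using emeasure_control_path_UNIV[OF path[OF that]] \<open>0 \<le> z\<close>
    by (intro subprob_spaceI) auto
  show "(\<lambda>\<omega>. emeasure (interval_measure (\<lambda>r. \<eta> r \<omega>)) UNIV) \<in> borel_measurable M"
    using emeasure_control_path_UNIV[OF path] by (subst measurable_cong[where g="\<lambda>_. ennreal (1 - z)"]) auto
  fix A assume "A \<in> range (\<lambda>(a, b). {a<..b::real})"
  then obtain a b where A: "A = {a<..b}"
    by auto
  have "(\<lambda>\<omega>. if a \<le> b then ennreal (\<eta> b \<omega> - \<eta> a \<omega>) else 0) \<in> borel_measurable M"
    by measurable
  then show "(\<lambda>\<omega>. emeasure (interval_measure (\<lambda>r. \<eta> r \<omega>)) A) \<in> borel_measurable M"
  proof (rule measurable_cong[THEN iffD1, rotated])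
    fix \<omega> assume "\<omega> \<in> space M"
    then have "mono (\<lambda>r. \<eta> r \<omega>)" "\<And>r. continuous (at_right r) (\<lambda>r. \<eta> r \<omega>)"
      using path by (auto simp: control_path_def)
    then show "(if a \<le> b then ennreal (\<eta> b \<omega> - \<eta> a \<omega>) else 0)
        = emeasure (interval_measure (\<lambda>r. \<eta> r \<omega>)) A"
      unfolding A by (subst emeasure_interval_measure_Ioc_eq) (auto dest: monoD)
  qed
qed auto

text \<open>A right-continuous process is the limit of its right-endpoint discretizations.\<close>

lemma right_continuous_jointly_measurable:
  fixes \<eta> :: "real \<Rightarrow> 'w \<Rightarrow> real"
  assumes [measurable]: "\<And>r. \<eta> r \<in> borel_measurable M"
    and cont: "\<And>\<omega> r. \<omega> \<in> space M \<Longrightarrow> continuous (at_right r) (\<lambda>r. \<eta> r \<omega>)"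
  shows "(\<lambda>(\<omega>, r). \<eta> r \<omega>) \<in> borel_measurable (M \<Otimes>\<^sub>M borel)"
proof (rule borel_measurable_LIMSEQ_real)
  \<comment> \<open>Right end of the dyadic interval of length \<open>1 / 2 ^ n\<close> containing
    \<open>r\<close>. Floor plus one, unlike the ceiling, is strictly above \<open>r\<close>, so the
    approximation stays in \<open>at_right r\<close>.\<close>
  define up where "up n r = real_of_int (\<lfloor>r * 2 ^ n\<rfloor> + 1) / 2 ^ n" for n :: nat and r :: real
  show "(\<lambda>n. case x of (\<omega>, r) \<Rightarrow> \<eta> (up n r) \<omega>) \<longlonglongrightarrow> (case x of (\<omega>, r) \<Rightarrow> \<eta> r \<omega>)"
    if "x \<in> space (M \<Otimes>\<^sub>M borel)" for x
  proof -
    obtain \<omega> r where x: "x = (\<omega>, r)"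
      by (cases x)
    with that have \<omega>: "\<omega> \<in> space M"
      by (simp add: space_pair_measure)
    have up: "r < up n r" "up n r \<le> r + 1 / 2 ^ n" for n
      unfolding up_def using floor_correct[of "r * 2 ^ n"] by (simp_all add: field_simps)
    have "(\<lambda>n. up n r) \<longlonglongrightarrow> r"
    proof (rule tendsto_sandwich[of "\<lambda>_. r" _ _ "\<lambda>n. r + 1 / 2 ^ n"])
      show "(\<lambda>n. r + 1 / 2 ^ n) \<longlonglongrightarrow> r"
        by real_asymp
    qed (use up in \<open>simp_all add: less_imp_le\<close>)
    moreover have "up n r \<noteq> r" for n
      using up(1)[of n] by simp
    ultimately have "filterlim (\<lambda>n. up n r) (at_right r) sequentially"
      using up by (simp add: filterlim_at)
    then show ?thesis
      using cont[OF \<omega>, of r] unfolding x continuous_within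
      by (auto intro: filterlim_compose)
  qed
  show "(\<lambda>x. case x of (\<omega>, r) \<Rightarrow> \<eta> (up n r) \<omega>) \<in> borel_measurable (M \<Otimes>\<^sub>M borel)" for n
  proof -
    have "(\<lambda>x. \<eta> (real_of_int (\<lfloor>snd x * 2 ^ n :: real\<rfloor> + 1) / 2 ^ n) (fst x)) \<in> borel_measurable (M \<Otimes>\<^sub>M borel)"
      by (rule measurable_compose_countable[where f="\<lambda>i x. \<eta> (real_of_int (i + 1) / 2 ^ n) (fst x)"])
        measurable
    then show ?thesis
      by (simp add: up_def split_beta')
  qed
qed

text \<open>Completeness enters here: sets that differ inside a null set are measurable
  together.\<close>

lemma (in complete_measure) measurable_AE_cong:
  assumes f: "f \<in> borel_measurable M" and eq: "AE x in M. f x = g x"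
  shows "g \<in> borel_measurable M"
proof (rule measurableI)
  fix A :: "'b set" assume "A \<in> sets borel"
  with f have "f -` A \<inter> space M \<in> sets M"
    by (rule measurable_sets)
  then show "g -` A \<inter> space M \<in> sets M"
    by (rule in_sets_AE[rotated]) (use eq in auto)
qed simp

lemma left_lim_eventually_const:
  assumes "u < r" "\<And>s. u < s \<Longrightarrow> s < r \<Longrightarrow> f s = k"
  shows "left_lim f r = k"
proof -
  have "(f \<longlongrightarrow> k) (at_left r)"
    using assms by (intro tendsto_eventually) (auto simp: eventually_at_left[OF \<open>u < r\<close>])
  then show ?thesis
    unfolding left_lim_def by (intro tendsto_Lim) auto
qed

section \<open>Expected cost of a control\<close>

context outer_problem
begin

definition running_cost :: "real \<Rightarrow> real \<Rightarrow> real \<Rightarrow> (real \<Rightarrow> real) \<Rightarrow> real" where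
  "running_cost lam x t G = (LINT r:{t..}|interval_measure G. U x t r)
     - lam * (LINT r:{t..}|lborel. exp (- \<beta> * (r - t)) * Ent (G r))"

text \<open>\<open>X\<close> at its own starting time is \<open>x\<close> for every
  \<open>\<omega>\<close>, so randomness enters the cost only through the control path.\<close>

lemma cost_eq: "cost lam x t \<eta> = expectation (\<lambda>\<omega>. running_cost lam x t (\<lambda>r. \<eta> r \<omega>))"
  by (simp add: cost_def running_cost_def X_def)

lemma Ent_continuous: "continuous_on {0..1} Ent"
  using Ent_differentiable by (rule differentiable_imp_continuous_on)

text \<open>\<open>Ent\<close> is arbitrary outside the unit interval, so it is clamped to make it measurable.\<close>

definition clamped_Ent :: "real \<Rightarrow> real" where
  "clamped_Ent y = Ent (max 0 (min 1 y))"

lemma clamped_Ent_eq: "y \<in> {0..1} \<Longrightarrow> clamped_Ent y = Ent y"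
  by (simp add: clamped_Ent_def)

lemma clamped_Ent_measurable [measurable]: "clamped_Ent \<in> borel_measurable borel"
  unfolding clamped_Ent_def[abs_def]
  by (intro borel_measurable_continuous_onI continuous_on_compose2[OF Ent_continuous] continuous_intros)
    auto

lemma bdd_Ent: "bdd_above (Ent ` {0..1})" "bdd_below (Ent ` {0..1})"
  using compact_continuous_image[OF Ent_continuous]
  by (auto intro: bounded_imp_bdd_above bounded_imp_bdd_below compact_imp_bounded)

lemma U_measurable [measurable]: "U x t \<in> borel_measurable borel"
  unfolding U_def[abs_def] by measurable

lemma running_cost_control_path:
  assumes "control_path t z G" "0 \<le> z"
  shows "running_cost lam x t G = (LINT r:{t..}|interval_measure G. U x t r)
     - lam * (LINT r:{t..}|lborel. exp (- \<beta> * (r - t)) * clamped_Ent (G r))"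
proof -
  have "clamped_Ent (G r) = Ent (G r)" for r
    using control_path_ge[OF assms(1), of r] control_path_le_1[OF assms(1), of r] assms(2)
    by (intro clamped_Ent_eq) auto
  then show ?thesis
    by (simp add: running_cost_def)
qed

text \<open>The lower estimate is the desired bound path by path; \<open>K\<close>, common to all
  control paths, supplies integrability over \<open>\<omega>\<close>.\<close>

lemma running_cost_bounds:
  assumes "0 < lam" "z \<in> {0..1}"
  obtains K where "\<And>G. control_path t z G \<Longrightarrow> running_cost lam x t G \<le> K"
    "\<And>G. control_path t z G \<Longrightarrow>
      V0 (x, t, z) - lam / \<beta> * (SUP z'\<in>{0..1}. Ent z') \<le> running_cost lam x t G"
proof -
  let ?S = "SUP z'\<in>{0..1}. Ent z'" and ?I = "INF z'\<in>{0..1}. Ent z'"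
  obtain K where K: "\<And>q. 0 \<le> q \<Longrightarrow> Psi x q \<le> K"
    using Psi_bounded_above[of x] by blast
  have both: "running_cost lam x t G \<le> K * (1 - z) - lam * (?I / \<beta>)"
    "V0 (x, t, z) - lam / \<beta> * ?S \<le> running_cost lam x t G" if G: "control_path t z G" for G
  proof -
    have z: "0 \<le> z" "z \<le> 1"
      using assms by auto
    have G_mono: "mono G"
      using G by (simp add: control_path_def)
    have [measurable]: "G \<in> borel_measurable borel"
      using G_mono by (rule borel_measurable_mono)
    have "clamped_Ent y \<in> Ent ` {0..1}" for y
      by (auto simp: clamped_Ent_def)
    then have ent: "?I \<le> clamped_Ent y" "clamped_Ent y \<le> ?S" for y
      using bdd_Ent by (metis cInf_lower, metis cSup_upper)
    have U: "Phi x \<le> U x t r" "U x t r \<le> K" if "t \<le> r" for r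
      using that Phi_le_Psi K by (auto simp: U_def)
    note 1 = set_integral_control_path_bounds[OF G U_measurable z(2) U]
    have m: "(\<lambda>r. clamped_Ent (G r)) \<in> borel_measurable borel"
      by measurable
    note 2 = discounted_integral_bounds[OF \<beta>_pos m ent, of t]
    note 3 = mult_left_mono[OF 2(1), of lam] mult_left_mono[OF 2(2), of lam]
    show "running_cost lam x t G \<le> K * (1 - z) - lam * (?I / \<beta>)"
      "V0 (x, t, z) - lam / \<beta> * ?S \<le> running_cost lam x t G"
      using 1 3 \<open>0 < lam\<close> unfolding running_cost_control_path[OF G z(1)]
      by (simp_all add: V0_def mult.commute)
  qed
  then show thesis by (rule that)
qed

lemma running_cost_measurable:
  assumes [measurable]: "\<And>r. \<eta> r \<in> borel_measurable M"
    and path: "\<And>\<omega>. \<omega> \<in> space M \<Longrightarrow> control_path t z (\<lambda>r. \<eta> r \<omega>)" and "0 \<le> z"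
  shows "(\<lambda>\<omega>. running_cost lam x t (\<lambda>r. \<eta> r \<omega>)) \<in> borel_measurable M"
proof -
  have "(\<lambda>m. LINT r:{t..}|m. U x t r) \<in> borel_measurable (subprob_algebra borel)"
    unfolding set_lebesgue_integral_def by measurable
  then have 1: "(\<lambda>\<omega>. LINT r:{t..}|interval_measure (\<lambda>r. \<eta> r \<omega>). U x t r) \<in> borel_measurable M"
    by (rule measurable_compose[rotated]) (rule measurable_interval_measure_control_path[OF assms])
  have [measurable]: "(\<lambda>(\<omega>, r). \<eta> r \<omega>) \<in> borel_measurable (M \<Otimes>\<^sub>M borel)"
    using path by (intro right_continuous_jointly_measurable) (auto simp: control_path_def)
  have 2: "(\<lambda>\<omega>. LINT r:{t..}|lborel. exp (- \<beta> * (r - t)) * clamped_Ent (\<eta> r \<omega>)) \<in> borel_measurable M"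
    unfolding set_lebesgue_integral_def by measurable
  show ?thesis
    using 1 2 by (subst measurable_cong[OF running_cost_control_path[OF path \<open>0 \<le> z\<close>]]) auto
qed

lemma controls_measurable:
  assumes "\<eta> \<in> controls t z" "0 \<le> t"
  shows "\<eta> r \<in> borel_measurable M"
proof (cases "t \<le> r")
  case True
  have B: "B u \<in> borel_measurable M" if "0 \<le> u" for u
    using measurable_from_subalg[OF F_subalgebra B_adapted] that by simp
  have nat_filt: "sets (nat_filt s) \<subseteq> sets M" for s
    unfolding nat_filt_def
    by (subst sets_measure_of) (auto intro!: sets.sigma_sets_subset measurable_sets[OF B])
  have "sets (FB r) \<subseteq> sets M"
  proof -
    have sub: "(\<Inter>s\<in>{r<..}. sets (nat_filt s)) \<subseteq> sets M"
      using nat_filt[of "r + 1"] by (auto dest: bspec[of _ _ "r + 1"])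
    moreover have "sets M \<subseteq> Pow (space M)"
      by (rule sets.space_closed)
    ultimately show ?thesis
      unfolding FB_def by (subst sets_measure_of) (auto intro!: sets.sigma_sets_subset)
  qed
  moreover have "space (FB r) = space M"
    by (simp add: FB_def space_measure_of_conv)
  moreover have "\<eta> r \<in> borel_measurable (FB r)"
    using assms True by (simp add: controls_def increasing_process_def)
  ultimately show ?thesis
    using measurable_from_subalg[of M "FB r"] by (simp add: subalgebra_def)
next
  case False
  then have "\<eta> r \<omega> = z" if "\<omega> \<in> space M" for \<omega>
    using assms that by (simp add: controls_def increasing_process_def)
  then show ?thesis
    by (subst measurable_cong[where g="\<lambda>_. z"]) auto
qed

lemma cost_ge:
  assumes \<eta>: "\<eta> \<in> controls t z" and "0 < lam" "0 \<le> t" and z: "z \<in> {0..1}"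
  shows "V0 (x, t, z) - lam / \<beta> * (SUP z'\<in>{0..1}. Ent z') \<le> cost lam x t \<eta>"
proof -
  let ?J = "\<lambda>\<eta> \<omega>. running_cost lam x t (\<lambda>r. \<eta> r \<omega>)"
  have "AE \<omega> in M. ((\<lambda>r. \<eta> r \<omega>) \<longlongrightarrow> 1) at_top"
    using \<eta> by (simp add: controls_def)
  then obtain N where N: "N \<in> null_sets M" "\<And>\<omega>. \<omega> \<in> space M - N \<Longrightarrow> ((\<lambda>r. \<eta> r \<omega>) \<longlongrightarrow> 1) at_top"
    by (auto elim!: AE_E3)
  have [measurable]: "N \<in> sets M"
    using N by auto
  \<comment> \<open>Controls tend to 1 only almost surely; on the exceptional set the immediate jump
    is substituted, so that every path is a control path.\<close>
  define \<eta>' where "\<eta>' r \<omega> = (if \<omega> \<in> N then (if r < t then z else 1) else \<eta> r \<omega>)" for r \<omega>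
  have path: "control_path t z (\<lambda>r. \<eta>' r \<omega>)" if "\<omega> \<in> space M" for \<omega>
    using that N(2)[of \<omega>] \<eta> control_path_jump[of z t] z
    by (cases "\<omega> \<in> N")
      (auto simp: \<eta>'_def[abs_def] control_path_def controls_def increasing_process_def)
  have AE: "AE \<omega> in M. ?J \<eta>' \<omega> = ?J \<eta> \<omega>"
    using AE_not_in[OF N(1)] by eventually_elim (simp add: \<eta>'_def)
  have [measurable]: "\<eta>' r \<in> borel_measurable M" for r
    using controls_measurable[OF \<eta> \<open>0 \<le> t\<close>] unfolding \<eta>'_def[abs_def] by measurable
  have J': "?J \<eta>' \<in> borel_measurable M"
    using z by (intro running_cost_measurable[OF _ path]) auto
  then have J: "?J \<eta> \<in> borel_measurable M"
    using AE by (rule measurable_AE_cong)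
  obtain K where K: "\<And>G. control_path t z G \<Longrightarrow> running_cost lam x t G \<le> K"
    "\<And>G. control_path t z G \<Longrightarrow>
      V0 (x, t, z) - lam / \<beta> * (SUP z'\<in>{0..1}. Ent z') \<le> running_cost lam x t G"
    using running_cost_bounds[OF \<open>0 < lam\<close> z] by metis
  have "V0 (x, t, z) - lam / \<beta> * (SUP z'\<in>{0..1}. Ent z') \<le> expectation (?J \<eta>')"
  proof (rule integral_ge_const)
    let ?L = "V0 (x, t, z) - lam / \<beta> * (SUP z'\<in>{0..1}. Ent z')"
    have "norm (?J \<eta>' \<omega>) \<le> \<bar>K\<bar> + \<bar>?L\<bar>" if "\<omega> \<in> space M" for \<omega>
      using K[OF path[OF that]] unfolding real_norm_def by linarith
    then show "integrable M (?J \<eta>')"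
      by (intro integrable_const_bound[OF _ J'] AE_I2)
    show "AE \<omega> in M. ?L \<le> ?J \<eta>' \<omega>"
      using K(2) path by (intro AE_I2) auto
  qed
  also have "expectation (?J \<eta>') = cost lam x t \<eta>"
    unfolding cost_eq using J' J AE by (rule integral_cong_AE)
  finally show ?thesis .
qed

text \<open>On \<open>{t..}\<close> the Stieltjes measure is an atom of mass \<open>1 - z\<close> at
  \<open>t\<close>, where \<open>U x t t\<close> is \<open>Phi x\<close>; from \<open>t\<close> on
  the entropy rate is constantly \<open>Ent 1\<close>.\<close>

lemma cost_jump:
  assumes "z \<le> 1"
  shows "cost lam x t (\<lambda>r \<omega>. if r < t then z else 1) = V0 (x, t, z) - lam / \<beta> * Ent 1"
proof -
  let ?G = "\<lambda>r. if r < t then z else 1"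
  let ?m = "interval_measure ?G"
  have G: "control_path t z ?G"
    using assms by (rule control_path_jump)
  have "emeasure ?m {t<..} = ennreal (1 - ?G t)"
    using G by (intro emeasure_interval_measure_Ioi) (auto simp: control_path_def)
  then have null: "AE r in ?m. r \<notin> {t<..}"
    by (intro AE_not_in) (auto intro!: null_setsI)
  have "(LINT r:{t..}|?m. U x t r) = (LINT r:{t..}|?m. Phi x)"
    unfolding set_lebesgue_integral_def
  proof (rule integral_cong_AE)
    show "AE r in ?m. indicator {t..} r *\<^sub>R U x t r = indicator {t..} r *\<^sub>R Phi x"
      using null by eventually_elim (auto simp: indicator_def U_def Psi_def)
  qed measurable
  also have "\<dots> = Phi x * (1 - z)"
    using set_integral_control_path_bounds[OF G, of "\<lambda>_. Phi x" "Phi x" "Phi x"] assms by auto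
  finally have 1: "(LINT r:{t..}|?m. U x t r) = Phi x * (1 - z)" .
  have "(LINT r:{t..}|lborel. exp (- \<beta> * (r - t)) * Ent (?G r))
      = (LINT r:{t..}|lborel. exp (- \<beta> * (r - t)) * Ent 1)"
    by (rule set_lebesgue_integral_cong) auto
  also have "\<dots> = Ent 1 / \<beta>"
    using set_integral_exp_discount(2)[OF \<beta>_pos, of t] by (simp del: mult_minus_left)
  finally show ?thesis
    unfolding cost_eq running_cost_def 1 by (simp add: V0_def prob_space mult.commute)
qed

text \<open>Admissibility places the whole slice \<open>z = 1\<close> in \<open>W\<close>, so the
  control is never pushed, whatever value the state component takes.\<close>

lemma reflection_solution_const_1:
  assumes "admissible W" "0 \<le> s" and \<zeta>: "\<And>\<omega>. \<zeta> \<omega> = 1"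
  shows "reflection_solution W s \<xi> \<zeta> (\<lambda>r \<omega>. 1)"
proof -
  have W: "(y, r, 1) \<in> W" if "s \<le> r" for y r
    using assms that by (auto simp: admissible_def)
  then have closure: "(y, r, 1) \<in> closure W" if "s \<le> r" for y r
    using that closure_subset by blast
  have "left_lim (\<lambda>u. 1) r = 1" for r
    by (rule left_lim_eventually_const[of "r - 1"]) auto
  then have outside: "indicator {s..r} r' *\<^sub>R indicator (- W) (left_lim (\<lambda>u. X \<xi> s u \<omega>) r', r', left_lim (\<lambda>u. 1) r') = (0::real)"
    for r r' \<omega>
    using W by (auto simp: indicator_def)
  show ?thesis
    unfolding reflection_solution_def increasing_process_def set_integrable_def set_lebesgue_integral_def
      Let_def outside
    using closure \<zeta> by (simp add: mono_def)
qed

section \<open>The equilibrium inequality and the vanishing-temperature limit\<close>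

lemma equilibrium_cost_le:
  assumes W: "equilibrium_law lam W" and state: "(x, t, z) \<in> state_space"
  shows "cost lam x t (generated_control W x t z) \<le> V0 (x, t, z) - lam / \<beta> * Ent 1"
proof -
  have t: "0 \<le> t" and z: "0 \<le> z" "z \<le> 1"
    using state by (auto simp: state_space_def)
  define \<eta> where "\<eta> r \<omega> = (if r < t then z else 1)" for r :: real and \<omega> :: 'w
  define \<Delta> where "\<Delta> = V0 (x, t, z) - lam / \<beta> * Ent 1 - cost lam x t (generated_control W x t z)"
  have path: "control_path t z (\<lambda>r. \<eta> r \<omega>)" for \<omega>
    unfolding \<eta>_def using z(2) by (rule control_path_jump)
  have \<eta>: "\<eta> \<in> controls t z"
    using path by (auto simp: controls_def increasing_process_def control_path_def) (auto simp: \<eta>_def[abs_def])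
  have cost_\<eta>: "cost lam x t \<eta> = V0 (x, t, z) - lam / \<beta> * Ent 1"
    unfolding \<eta>_def using z(2) by (rule cost_jump)
  have concat: "concat_control (t + h) \<eta> (\<lambda>r \<omega>. 1) = \<eta>" if "0 < h" for h
    using that by (auto simp: concat_control_def \<eta>_def fun_eq_iff)
  have left: "left_lim (\<lambda>r. \<eta> r \<omega>) (t + h) = 1" if "0 < h" for h \<omega>
    using that by (intro left_lim_eventually_const[of t]) (auto simp: \<eta>_def)
  have pos: "\<forall>\<^sub>F h :: real in at_right 0. 0 < h"
    by (rule eventually_at_right_less)
  \<comment> \<open>The growth condition is measured from \<open>\<eta> t\<close>, after the jump,
    so the increment is 0 and any positive constant works.\<close>
  have "\<forall>\<^sub>F h in at_right 0. AE \<omega> in M. left_lim (\<lambda>r. \<eta> r \<omega>) (t + h) - \<eta> t \<omega> \<le> 1 * h"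
    using pos
  proof eventually_elim
    case (elim h)
    then have "left_lim (\<lambda>r. \<eta> r \<omega>) (t + h) - \<eta> t \<omega> \<le> 1 * h" for \<omega>
      unfolding left[OF elim] by (simp add: \<eta>_def)
    then show ?case by simp
  qed
  then have small: "\<exists>K>0. \<forall>\<^sub>F h in at_right 0. AE \<omega> in M. left_lim (\<lambda>r. \<eta> r \<omega>) (t + h) - \<eta> t \<omega> \<le> K * h"
    using zero_less_one by blast
  have continuation: "\<forall>\<^sub>F h in at_right 0.
      reflection_solution W (t + h) (\<lambda>\<omega>. left_lim (\<lambda>r. X (\<lambda>_. x) t r \<omega>) (t + h))
        (\<lambda>\<omega>. left_lim (\<lambda>r. \<eta> r \<omega>) (t + h)) (\<lambda>r \<omega>. 1) \<and>
      concat_control (t + h) \<eta> (\<lambda>r \<omega>. 1) \<in> controls t z"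
    using pos
  proof eventually_elim
    case (elim h)
    then show ?case
      using W t \<eta> left concat by (auto simp: equilibrium_law_def intro!: reflection_solution_const_1)
  qed
  have "0 \<le> Liminf (at_right 0) (\<lambda>h. ereal
      ((cost lam x t (concat_control (t + h) \<eta> (\<lambda>r \<omega>. 1)) - cost lam x t (generated_control W x t z)) / h))"
    using W[unfolded equilibrium_law_def, THEN conjunct2, rule_format, OF state \<eta> small continuation] .
  also have "\<dots> = Liminf (at_right 0) (\<lambda>h. ereal (\<Delta> / h))"
  proof (rule Liminf_eq)
    show "\<forall>\<^sub>F h in at_right 0. ereal ((cost lam x t (concat_control (t + h) \<eta> (\<lambda>r \<omega>. 1))
        - cost lam x t (generated_control W x t z)) / h) = ereal (\<Delta> / h)"
      using pos by eventually_elim (simp add: concat \<Delta>_def cost_\<eta>)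
  qed
  finally have Liminf: "0 \<le> Liminf (at_right 0) (\<lambda>h. ereal (\<Delta> / h))" .
  have "0 \<le> \<Delta>"
  proof (rule ccontr)
    assume "\<not> 0 \<le> \<Delta>"
    \<comment> \<open>For negative \<open>\<Delta>\<close> and \<open>0 < h < 1\<close>, dividing by
      \<open>h\<close> only decreases \<open>\<Delta>\<close>, so the lower limit would be
      negative.\<close>
    have "Liminf (at_right 0) (\<lambda>h. ereal (\<Delta> / h)) \<le> Liminf (at_right 0) (\<lambda>h::real. ereal \<Delta>)"
    proof (rule Liminf_mono)
      have "\<forall>\<^sub>F h :: real in at_right 0. h < 1"
        by (rule eventually_at_rightI[of 0 1]) auto
      then show "\<forall>\<^sub>F h in at_right 0. ereal (\<Delta> / h) \<le> ereal \<Delta>"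
        using pos by eventually_elim (use \<open>\<not> 0 \<le> \<Delta>\<close> in \<open>auto simp: field_simps mult_le_cancel_left\<close>)
    qed
    also have "\<dots> = ereal \<Delta>"
      by (simp add: Liminf_const)
    finally have "Liminf (at_right 0) (\<lambda>h. ereal (\<Delta> / h)) \<le> ereal \<Delta>" .
    with Liminf have "0 \<le> ereal \<Delta>"
      by (rule order_trans)
    with \<open>\<not> 0 \<le> \<Delta>\<close> show False
      by simp
  qed
  then show ?thesis
    by (simp add: \<Delta>_def)
qed

lemma equilibrium_value_bounds:
  assumes V: "equilibrium_value_function lam V" and "0 < lam" and state: "(x, t, z) \<in> state_space"
  shows "V0 (x, t, z) - lam / \<beta> * (SUP z'\<in>{0..1}. Ent z') \<le> V (x, t, z)"
    and "V (x, t, z) \<le> V0 (x, t, z) - lam / \<beta> * Ent 1"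
proof -
  obtain W where W: "equilibrium_law lam W" "V (x, t, z) = cost lam x t (generated_control W x t z)"
    using V state by (auto simp: equilibrium_value_function_def)
  then have "generated_control W x t z \<in> controls t z"
    using state by (auto simp: equilibrium_law_def admissible_def)
  then show "V0 (x, t, z) - lam / \<beta> * (SUP z'\<in>{0..1}. Ent z') \<le> V (x, t, z)"
    unfolding W(2) using state \<open>0 < lam\<close> by (intro cost_ge) (auto simp: state_space_def)
  show "V (x, t, z) \<le> V0 (x, t, z) - lam / \<beta> * Ent 1"
    unfolding W(2) by (rule equilibrium_cost_le[OF W(1) state])
qed

text \<open>Existence is supposed only for temperatures in \<open>\<Lambda>\<close>; if these do not
  accumulate at 0, the filter is trivial and the claim vacuous.\<close>

lemma equilibrium_value_uniform_limit:
  assumes \<Lambda>: "\<Lambda> \<subseteq> {0<..}" and V: "\<And>lam. lam \<in> \<Lambda> \<Longrightarrow> equilibrium_value_function lam (V lam)"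
  shows "uniform_limit state_space V V0 (at 0 within \<Lambda>)"
proof (rule uniform_limitI)
  fix e :: real assume "0 < e"
  \<comment> \<open>Free of the state and large enough for both entropy corrections, which are then
    at most \<open>lam * k\<close> in absolute value.\<close>
  define k where "k = (\<bar>SUP z'\<in>{0..1}. Ent z'\<bar> + \<bar>Ent 1\<bar>) / \<beta>"
  have "((\<lambda>lam. lam * k) \<longlongrightarrow> 0) (at 0 within \<Lambda>)"
    by (auto intro!: tendsto_eq_intros)
  then have "\<forall>\<^sub>F lam in at 0 within \<Lambda>. lam * k < e"
    using \<open>0 < e\<close> by (rule order_tendstoD)
  moreover have "\<forall>\<^sub>F lam in at 0 within \<Lambda>. lam \<in> \<Lambda>"
    by (simp add: eventually_at_filter)
  ultimately show "\<forall>\<^sub>F lam in at 0 within \<Lambda>. \<forall>s\<in>state_space. dist (V lam s) (V0 s) < e"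
  proof eventually_elim
    case (elim lam)
    then have "0 < lam"
      using \<Lambda> by auto
    show ?case
    proof
      fix s assume s: "s \<in> state_space"
      obtain x t z where xtz: "s = (x, t, z)"
        by (cases s)
      have "\<bar>lam / \<beta> * y\<bar> \<le> lam * k" if "\<bar>y\<bar> \<le> \<beta> * k" for y
        using mult_left_mono[OF that, of "lam / \<beta>"] \<open>0 < lam\<close> \<beta>_pos by (simp add: abs_mult)
      moreover have "\<bar>SUP z'\<in>{0..1}. Ent z'\<bar> \<le> \<beta> * k" "\<bar>Ent 1\<bar> \<le> \<beta> * k"
        using \<beta>_pos by (auto simp: k_def)
      ultimately have "\<bar>lam / \<beta> * (SUP z'\<in>{0..1}. Ent z')\<bar> \<le> lam * k" "\<bar>lam / \<beta> * Ent 1\<bar> \<le> lam * k"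
        by blast+
      then show "dist (V lam s) (V0 s) < e"
        using equilibrium_value_bounds[OF V[OF elim(2)] \<open>0 < lam\<close> s[unfolded xtz]] elim(1)
        unfolding xtz dist_real_def by linarith
    qed
  qed
qed

end

theorem proposition4p6:
  fixes M :: "'w measure"
    and F :: "real \<Rightarrow> 'w measure"
    and B :: "real \<Rightarrow> 'w \<Rightarrow> real"
    and \<mu> \<sigma> a c \<beta> :: real
    and Ent :: "real \<Rightarrow> real"
  assumes "outer_problem M F B \<mu> \<sigma> a c \<beta> Ent"
  defines "V0 \<equiv> outer_problem.V0 \<mu> \<sigma> a c \<beta>"
    and "is_equilibrium_value \<equiv>
           outer_problem.equilibrium_value_function M B \<mu> \<sigma> a c \<beta> Ent"
  shows "(\<forall>lam>0. \<forall>V. is_equilibrium_value lam V \<longrightarrow>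
            (\<forall>x t z. (x, t, z) \<in> state_space \<longrightarrow>
               V0 (x, t, z) - lam / \<beta> * (SUP z'\<in>{0..1}. Ent z') \<le> V (x, t, z) \<and>
               V (x, t, z) \<le> V0 (x, t, z) - lam / \<beta> * Ent 1)) \<and>
         (\<forall>\<Lambda> V. \<Lambda> \<subseteq> {0<..} \<longrightarrow> (\<forall>lam\<in>\<Lambda>. is_equilibrium_value lam (V lam)) \<longrightarrow>
            uniform_limit state_space V V0 (at 0 within \<Lambda>))"
proof -
  interpret outer: outer_problem M F B \<mu> \<sigma> a c \<beta> Ent
    by fact
  show ?thesis
    unfolding V0_def is_equilibrium_value_def
    by (intro conjI allI impI outer.equilibrium_value_bounds
        outer.equilibrium_value_uniform_limit) auto
qed

end
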